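(* Let $n\geqslant 1$. Assume that all $\mathbf{\Delta}^1_n$-subsets of Polish spaces are Baire-measurable. Suppose that $\mathcal{F}$ is a filter on $\mathbb{N}$ that is a $\mathbf{\Sigma}^1_n$-subset of $\{0,1\}^{\mathbb{N}}$. Then for every Banach space $X$ over $\mathbb{K}$ and every $\mathcal{F}$-basis $(e_k)_{k=1}^\infty$ of $X$, the corresponding coordinate functionals $e_k^*\colon X\to\mathbb{K}$ ($k\in\mathbb{N}$) are continuous.
   Context: $\mathbb{K}$ is the fixed scalar field, either $\mathbb{R}$ or $\mathbb{C}$. A filter on $\mathbb{N}=\{1,2,\dots\}$ is a family of subsets of $\mathbb{N}$ closed under finite intersections and upwards-closed with respect to inclusion; by convention, every filter is assumed to contain all cofinite subsets of $\mathbb{N}$. Subsets of $\mathbb{N}$ are identified with their characteristic functions, so a filter is regarded as a subset of the Cantor set $\{0,1\}^{\mathbb{N}}$ with the product topology. Projective (boldface) classes of subsets of Polish spaces: $\mathbf{\Sigma}^1_1$-sets are the analytic sets (continuous images of Polish spaces, together with the empty set); $\mathbf{\Pi}^1_n$-sets are complements of $\mathbf{\Sigma}^1_n$-sets; $\mathbf{\Sigma}^1_{n+1}$-subsets of a Polish space $Y$ are the projections to $Y$ of $\mathbf{\Pi}^1_n$-subsets of $Y\times\mathbb{N}^{\mathbb{N}}$; a set is $\mathbf{\Delta}^1_n$ if it is both $\mathbf{\Sigma}^1_n$ and $\mathbf{\Pi}^1_n$. A subset of a Polish space is Baire-measurable if it has the Baire property, i.e. its symmetric difference with some open set is meagre.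 A sequence $(x_k)_{k=1}^\infty$ in a normed space $\mathcal{F}$-converges to $x$ if for every $\varepsilon>0$ there is $A\in\mathcal{F}$ such that $\|x-x_k\|<\varepsilon$ for all $k\in A$. A sequence $(e_k)_{k=1}^\infty$ in a Banach space $X$ is an $\mathcal{F}$-basis of $X$ if for each $x\in X$ there is a unique sequence of scalars $(e_k^*(x))_{k=1}^\infty$ such that $x=\sum_{k,\mathcal{F}}e_k^*(x)e_k$, meaning that the partial sums $\sum_{i=1}^k e_i^*(x)e_i$ $\mathcal{F}$-converge to $x$. The linear maps $x\mapsto e_k^*(x)$ are the coordinate functionals of the basis. *)

theory Defs
  imports "HOL-Analysis.Analysis"
begin

section \<open>Descriptive set theory\<close>

definition Polish :: "'a topology \<Rightarrow> bool" where
  "Polish X \<longleftrightarrow> completely_metrizable_space X \<and> separable_space X"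

abbreviation baire_space :: "(nat \<Rightarrow> nat) topology" where
  "baire_space \<equiv> product_topology (\<lambda>_. discrete_topology UNIV) UNIV"

abbreviation cantor_space :: "(nat \<Rightarrow> bool) topology" where
  "cantor_space \<equiv> product_topology (\<lambda>_. discrete_topology UNIV) UNIV"

definition nowhere_dense_in :: "'a topology \<Rightarrow> 'a set \<Rightarrow> bool" where
  "nowhere_dense_in X S \<longleftrightarrow> S \<subseteq> topspace X \<and> X interior_of (X closure_of S) = {}"

definition meagre_in :: "'a topology \<Rightarrow> 'a set \<Rightarrow> bool" where
  "meagre_in X S \<longleftrightarrow> (\<exists>D. countable D \<and> (\<forall>T\<in>D. nowhere_dense_in X T) \<and> S = \<Union>D)"

definition Baire_measurable :: "'a topology \<Rightarrow> 'a set \<Rightarrow> bool" where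
  "Baire_measurable X A \<longleftrightarrow>
     A \<subseteq> topspace X \<and> (\<exists>U. openin X U \<and> meagre_in X ((A - U) \<union> (U - A)))"

text \<open>A Polish space has at most continuum many points, so up to homeomorphism every Polish space
  is a topology whose points form a subset of the type \<^typ>\<open>nat \<Rightarrow> nat\<close>. A quantifier over all Polish
  spaces inside a formula is therefore rendered as one over \<^typ>\<open>(nat \<Rightarrow> nat) topology\<close>.\<close>

definition analytic_in :: "'a topology \<Rightarrow> 'a set \<Rightarrow> bool" where
  "analytic_in X A \<longleftrightarrow> A = {} \<or>
     (\<exists>(P :: (nat \<Rightarrow> nat) topology) f. Polish P \<and> continuous_map P X f \<and> f ` topspace P = A)"

text \<open>The passage from \<open>\<Sigma>\<^sup>1\<^sub>n\<close> to \<open>\<Sigma>\<^sup>1\<^sub>n\<^sub>+\<^sub>1\<close> replaces \<open>Y\<close> by \<open>Y \<times> \<nat>\<^sup>\<nat>\<close>, which would change the type in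
  the recursion. So the subsets of all the spaces \<open>Y \<times> (\<nat>\<^sup>\<nat>)\<^sup>m\<close> are treated simultaneously, with
  \<open>(\<nat>\<^sup>\<nat>)\<^sup>m\<close> a product over the index set \<^term>\<open>{..<m}\<close>; the space \<open>(\<nat>\<^sup>\<nat>)\<^sup>0\<close> has the single point
  \<^term>\<open>\<lambda>_. undefined\<close>. The lemmas \<open>Sigma1_1\<close> and \<open>Sigma1_Suc\<close> below are the usual
  defining clauses.\<close>

definition times_baire :: "'a topology \<Rightarrow> nat \<Rightarrow> ('a \<times> (nat \<Rightarrow> nat \<Rightarrow> nat)) topology" where
  "times_baire Y m = prod_topology Y (product_topology (\<lambda>_. baire_space) {..<m})"

fun Sigma1_times :: "nat \<Rightarrow> 'a topology \<Rightarrow> nat \<Rightarrow> ('a \<times> (nat \<Rightarrow> nat \<Rightarrow> nat)) set \<Rightarrow> bool" where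
  "Sigma1_times 0 Y m A \<longleftrightarrow> False"
| "Sigma1_times (Suc 0) Y m A \<longleftrightarrow> analytic_in (times_baire Y m) A"
| "Sigma1_times (Suc (Suc n)) Y m A \<longleftrightarrow>
     (\<exists>B \<subseteq> topspace (times_baire Y (Suc m)).
        Sigma1_times (Suc n) Y (Suc m) (topspace (times_baire Y (Suc m)) - B) \<and>
        A = (\<lambda>(y, f). (y, restrict f {..<m})) ` B)"

definition Sigma1 :: "nat \<Rightarrow> 'a topology \<Rightarrow> 'a set \<Rightarrow> bool" where
  "Sigma1 n Y A \<longleftrightarrow> Sigma1_times n Y 0 (A \<times> {\<lambda>_. undefined})"

definition Pi1 :: "nat \<Rightarrow> 'a topology \<Rightarrow> 'a set \<Rightarrow> bool" where
  "Pi1 n Y A \<longleftrightarrow> A \<subseteq> topspace Y \<and> Sigma1 n Y (topspace Y - A)"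

definition Delta1 :: "nat \<Rightarrow> 'a topology \<Rightarrow> 'a set \<Rightarrow> bool" where
  "Delta1 n Y A \<longleftrightarrow> Sigma1 n Y A \<and> Pi1 n Y A"

lemma analytic_in_continuous_image:
  assumes "analytic_in X A" "continuous_map X Y h"
  shows "analytic_in Y (h ` A)"
proof (cases "A = {}")
  case False
  then obtain P :: "(nat \<Rightarrow> nat) topology" and f
    where "Polish P" "continuous_map P X f" "f ` topspace P = A"
    using assms(1) unfolding analytic_in_def by blast
  then have "continuous_map P Y (h \<circ> f)" "(h \<circ> f) ` topspace P = h ` A"
    using assms(2) continuous_map_compose by (blast, metis image_comp)
  with \<open>Polish P\<close> show ?thesis unfolding analytic_in_def by blast
qed (simp add: analytic_in_def)

lemma topspace_times_baire: "topspace (times_baire Y m) = topspace Y \<times> extensional {..<m}"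
  by (simp add: times_baire_def PiE_def)

lemma Sigma1_1: "Sigma1 1 Y A \<longleftrightarrow> analytic_in Y A"
proof
  assume "Sigma1 1 Y A"
  then have "analytic_in (times_baire Y 0) (A \<times> {\<lambda>_. undefined})"
    by (simp add: Sigma1_def)
  from analytic_in_continuous_image[OF this, of Y fst] show "analytic_in Y A"
    by (simp add: times_baire_def continuous_map_fst)
next
  assume A: "analytic_in Y A"
  have "continuous_map Y (times_baire Y 0) (\<lambda>y. (y, \<lambda>_. undefined))"
    by (auto simp: times_baire_def continuous_map_pairwise o_def)
  from analytic_in_continuous_image[OF A this]
  have "analytic_in (times_baire Y 0) ((\<lambda>y. (y, \<lambda>_. undefined)) ` A)" .
  moreover have "(\<lambda>y. (y, (\<lambda>_. undefined) :: nat \<Rightarrow> nat \<Rightarrow> nat)) ` A = A \<times> {\<lambda>_. undefined}"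
    by auto
  ultimately show "Sigma1 1 Y A" by (simp add: Sigma1_def)
qed

definition regroup :: "nat \<Rightarrow> 'a \<times> (nat \<Rightarrow> nat \<Rightarrow> nat) \<Rightarrow> ('a \<times> (nat \<Rightarrow> nat)) \<times> (nat \<Rightarrow> nat \<Rightarrow> nat)" where
  "regroup m = (\<lambda>(y, f). ((y, f 0), \<lambda>i\<in>{..<m}. f (Suc i)))"

definition ungroup :: "nat \<Rightarrow> ('a \<times> (nat \<Rightarrow> nat)) \<times> (nat \<Rightarrow> nat \<Rightarrow> nat) \<Rightarrow> 'a \<times> (nat \<Rightarrow> nat \<Rightarrow> nat)" where
  "ungroup m = (\<lambda>((y, g), f). (y, \<lambda>i\<in>{..<Suc m}. case i of 0 \<Rightarrow> g | Suc j \<Rightarrow> f j))"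

lemma continuous_map_regroup:
  "continuous_map (times_baire Y (Suc m)) (times_baire (prod_topology Y baire_space) m) (regroup m)"
proof -
  let ?P = "product_topology (\<lambda>_. baire_space) {..<Suc m}"
  have proj: "continuous_map (prod_topology Y ?P) baire_space (\<lambda>x. snd x i)" if "i < Suc m" for i
    using continuous_map_compose[OF continuous_map_snd
      continuous_map_product_projection[of i "{..<Suc m}" "\<lambda>_. baire_space"], of Y] that
    by (simp add: o_def)
  have reg: "regroup m = (\<lambda>x. ((fst x, snd x 0), \<lambda>i\<in>{..<m}. snd x (Suc i)))"
    by (auto simp: regroup_def fun_eq_iff)
  have "continuous_map (prod_topology Y ?P) (product_topology (\<lambda>_. baire_space) {..<m})
          (\<lambda>x. \<lambda>i\<in>{..<m}. snd x (Suc i))"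
    unfolding continuous_map_componentwise[of _ "\<lambda>_. baire_space"] using proj by auto
  then show ?thesis
    unfolding times_baire_def reg
    by (intro continuous_map_pairedI continuous_map_fst proj) auto
qed

lemma continuous_map_ungroup:
  "continuous_map (times_baire (prod_topology Y baire_space) m) (times_baire Y (Suc m)) (ungroup m)"
proof -
  let ?T = "times_baire (prod_topology Y baire_space) m"
  have un: "ungroup m = (\<lambda>x. (fst (fst x),
      \<lambda>i\<in>{..<Suc m}. case i of 0 \<Rightarrow> snd (fst x) | Suc j \<Rightarrow> snd x j))"
    by (auto simp: ungroup_def fun_eq_iff)
  have 1: "continuous_map ?T Y (\<lambda>x. fst (fst x))"
    unfolding times_baire_def using continuous_map_compose[OF continuous_map_fst continuous_map_fst]
    by (simp add: o_def)
  have 2: "continuous_map ?T baire_space (\<lambda>x. snd (fst x))"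
    unfolding times_baire_def using continuous_map_compose[OF continuous_map_fst continuous_map_snd]
    by (simp add: o_def)
  have 3: "continuous_map ?T baire_space (\<lambda>x. snd x i)" if "i < m" for i
    unfolding times_baire_def using continuous_map_compose[OF continuous_map_snd
      continuous_map_product_projection[of i "{..<m}" "\<lambda>_. baire_space"]] that
    by (simp add: o_def)
  have "continuous_map ?T (product_topology (\<lambda>_. baire_space) {..<Suc m})
          (\<lambda>x. \<lambda>i\<in>{..<Suc m}. case i of 0 \<Rightarrow> snd (fst x) | Suc j \<Rightarrow> snd x j)"
    unfolding continuous_map_componentwise[of _ "\<lambda>_. baire_space"]
  proof (intro conjI ballI)
    fix i assume "i \<in> {..<Suc m}"
    then show "continuous_map ?T baire_space
        (\<lambda>x. (\<lambda>i\<in>{..<Suc m}. case i of 0 \<Rightarrow> snd (fst x) | Suc j \<Rightarrow> snd x j) i)"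
      using 2 3 by (cases i) auto
  qed auto
  then show ?thesis
    unfolding un times_baire_def[of Y "Suc m"] by (intro continuous_map_pairedI 1) auto
qed

lemma ungroup_regroup:
  "x \<in> topspace (times_baire Y (Suc m)) \<Longrightarrow> ungroup m (regroup m x) = x"
  by (cases x) (auto simp: topspace_times_baire regroup_def ungroup_def extensional_def fun_eq_iff
      split: nat.split)

lemma regroup_ungroup:
  "x \<in> topspace (times_baire (prod_topology Y baire_space) m) \<Longrightarrow> regroup m (ungroup m x) = x"
  by (cases x) (auto simp: topspace_times_baire regroup_def ungroup_def extensional_def fun_eq_iff)

lemma regroup_image:
  "regroup m ` topspace (times_baire Y (Suc m)) =
   topspace (times_baire (prod_topology Y baire_space) m)"
proof
  show "regroup m ` topspace (times_baire Y (Suc m)) \<subseteq>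
      topspace (times_baire (prod_topology Y baire_space) m)"
    using continuous_map_regroup[of Y m] by (auto simp: continuous_map_def)
  show "topspace (times_baire (prod_topology Y baire_space) m) \<subseteq>
      regroup m ` topspace (times_baire Y (Suc m))"
  proof
    fix z assume z: "z \<in> topspace (times_baire (prod_topology Y baire_space) m)"
    then have "ungroup m z \<in> topspace (times_baire Y (Suc m))"
      by (rule continuous_map_image_subset_topspace[OF continuous_map_ungroup, THEN subsetD, OF imageI])
    then show "z \<in> regroup m ` topspace (times_baire Y (Suc m))"
      using regroup_ungroup[OF z] by (metis imageI)
  qed
qed

lemma inj_on_regroup: "inj_on (regroup m) (topspace (times_baire Y (Suc m)))"
  by (metis inj_on_inverseI ungroup_regroup)

lemma regroup_restrict:
  "(\<lambda>(y, f). (y, restrict f {..<m})) (regroup (Suc m) x) =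
   regroup m ((\<lambda>(y, f). (y, restrict f {..<Suc m})) x)"
  by (cases x) (auto simp: regroup_def fun_eq_iff)

lemma exists_subset_image_iff: "(\<exists>B'\<subseteq>f ` T. P B') \<longleftrightarrow> (\<exists>B\<subseteq>T. P (f ` B))"
  by (metis subset_image_iff)

lemma Sigma1_times_regroup:
  assumes "A \<subseteq> topspace (times_baire Y (Suc m))"
  shows "Sigma1_times n Y (Suc m) A \<longleftrightarrow>
         Sigma1_times n (prod_topology Y baire_space) m (regroup m ` A)"
  using assms
proof (induction n arbitrary: m A rule: less_induct)
  case (less n)
  let ?Z = "prod_topology Y baire_space"
  consider "n = 0" | "n = Suc 0" | k where "n = Suc (Suc k)"
    by (metis not0_implies_Suc)
  then show ?case
  proof cases
    case 2
    have "ungroup m ` regroup m ` A = A"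
      using ungroup_regroup less.prems by (force simp: image_iff)
    then show ?thesis
      using 2 analytic_in_continuous_image[OF _ continuous_map_regroup]
        analytic_in_continuous_image[OF _ continuous_map_ungroup[of Y m]]
      by (metis Sigma1_times.simps(2))
  next
    case 3
    let ?p = "\<lambda>m (y, f). (y, restrict f {..<m})"
    let ?T = "topspace (times_baire Y (Suc (Suc m)))"
    let ?T' = "topspace (times_baire ?Z (Suc m))"
    let ?r = "regroup (Suc m)"
    have eq: "Sigma1_times (Suc k) Y (Suc (Suc m)) (?T - B) \<and> A = ?p (Suc m) ` B \<longleftrightarrow>
              Sigma1_times (Suc k) ?Z (Suc m) (?T' - ?r ` B) \<and> regroup m ` A = ?p m ` ?r ` B"
      if B: "B \<subseteq> ?T" for B
    proof -
      have "?r ` (?T - B) = ?T' - ?r ` B"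
        using inj_on_image_set_diff[OF inj_on_regroup[of "Suc m" Y], of ?T B] B regroup_image[of "Suc m" Y]
        by blast
      moreover have "?p m ` ?r ` B = regroup m ` ?p (Suc m) ` B"
        by (simp add: image_image regroup_restrict)
      moreover have "?p (Suc m) ` B \<subseteq> topspace (times_baire Y (Suc m))"
        using B by (auto simp: topspace_times_baire)
      then have "regroup m ` A = regroup m ` ?p (Suc m) ` B \<longleftrightarrow> A = ?p (Suc m) ` B"
        by (rule inj_on_image_eq_iff[OF inj_on_regroup less.prems])
      ultimately show ?thesis
        using less.IH[of "Suc k" "?T - B" "Suc m"] 3 by simp
    qed
    have "(\<exists>B\<subseteq>?T. Sigma1_times (Suc k) Y (Suc (Suc m)) (?T - B) \<and> A = ?p (Suc m) ` B) \<longleftrightarrow>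
          (\<exists>B\<subseteq>?T. Sigma1_times (Suc k) ?Z (Suc m) (?T' - ?r ` B) \<and> regroup m ` A = ?p m ` ?r ` B)"
      by (intro ex_cong1 conj_cong refl eq)
    also have "\<dots> \<longleftrightarrow> (\<exists>B'\<subseteq>?T'. Sigma1_times (Suc k) ?Z (Suc m) (?T' - B') \<and>
                             regroup m ` A = ?p m ` B')"
      unfolding regroup_image[of "Suc m" Y, symmetric] exists_subset_image_iff ..
    finally show ?thesis using 3 by simp
  qed simp
qed

lemma times_singleton_eq_iff: "S \<times> {u} = T \<times> {u} \<longleftrightarrow> S = T"
  by (auto simp: times_eq_iff)

lemma Sigma1_Suc:
  fixes Y :: "'a topology"
  assumes "n \<ge> 1"
  shows "Sigma1 (Suc n) Y A \<longleftrightarrow> (\<exists>B. Pi1 n (prod_topology Y baire_space) B \<and> A = fst ` B)"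
proof -
  let ?Z = "prod_topology Y baire_space"
  let ?T = "topspace (times_baire Y (Suc 0))"
  let ?s = "\<lambda>x :: 'a \<times> (nat \<Rightarrow> nat \<Rightarrow> nat). (fst x, snd x 0)"
  let ?u = "(\<lambda>_. undefined) :: nat \<Rightarrow> nat \<Rightarrow> nat"
  obtain k where n: "n = Suc k" using assms by (cases n) auto
  have reg0: "regroup 0 = (\<lambda>x. (?s x, \<lambda>_. undefined))"
    by (rule ext) (auto simp: regroup_def)
  have reg: "regroup 0 ` C = (?s ` C) \<times> {\<lambda>_. undefined}" for C :: "('a \<times> (nat \<Rightarrow> nat \<Rightarrow> nat)) set"
    unfolding reg0 by auto
  have inj: "inj_on ?s ?T"
    using inj_on_regroup[of 0 Y] unfolding reg0 inj_on_def by simp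
  have "?s ` ?T \<times> {?u} = topspace ?Z \<times> {?u}"
    using regroup_image[of 0 Y] unfolding reg topspace_times_baire[of ?Z] by simp
  then have im: "?s ` ?T = topspace ?Z"
    by (simp only: times_singleton_eq_iff)
  have 1: "Sigma1_times n Y (Suc 0) (?T - B) \<longleftrightarrow> Sigma1 n ?Z (topspace ?Z - ?s ` B)"
    if B: "B \<subseteq> ?T" for B
  proof -
    have "?s ` (?T - B) = ?s ` ?T - ?s ` B"
      by (rule inj_on_image_set_diff[OF inj _ B]) blast
    then show ?thesis
      by (simp only: im Sigma1_def Sigma1_times_regroup[OF Diff_subset] reg)
  qed
  have 2: "A \<times> {?u} = (\<lambda>(y, f). (y, restrict f {..<0})) ` B \<longleftrightarrow> A = fst ` ?s ` B"
    for B :: "('a \<times> (nat \<Rightarrow> nat \<Rightarrow> nat)) set"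
  proof -
    have "(\<lambda>(y, f). (y, restrict f {..<0})) ` B = (\<lambda>x. (fst x, ?u)) ` B"
      by (rule image_cong) auto
    also have "\<dots> = (fst ` B) \<times> {?u}"
      by auto
    finally have B: "(\<lambda>(y, f). (y, restrict f {..<0})) ` B = (fst ` B) \<times> {?u}" .
    have "fst ` ?s ` B = fst ` B"
      by (simp only: image_image fst_conv)
    then show ?thesis
      by (simp only: B times_singleton_eq_iff)
  qed
  have "Sigma1 (Suc n) Y A \<longleftrightarrow> (\<exists>B\<subseteq>?T. Sigma1_times n Y (Suc 0) (?T - B) \<and>
          A \<times> {\<lambda>_. undefined} = (\<lambda>(y, f). (y, restrict f {..<0})) ` B)"
    unfolding Sigma1_def n Sigma1_times.simps ..
  also have "\<dots> \<longleftrightarrow> (\<exists>B\<subseteq>?T. Sigma1 n ?Z (topspace ?Z - ?s ` B) \<and> A = fst ` ?s ` B)"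
    by (rule ex_cong1, rule conj_cong, rule refl, rule conj_cong, erule 1, rule 2)
  also have "\<dots> \<longleftrightarrow> (\<exists>B\<subseteq>topspace ?Z. Sigma1 n ?Z (topspace ?Z - B) \<and> A = fst ` B)"
    unfolding im[symmetric] exists_subset_image_iff ..
  finally show ?thesis by (simp only: Pi1_def conj_assoc)
qed

section \<open>Bases with respect to a filter\<close>

text \<open>The libraries have no class of complex Banach spaces. A complex Banach space is a real one
  together with a complex scalar multiplication extending the real one.\<close>

locale complex_banach = vector_space mul
  for mul :: "complex \<Rightarrow> 'a::banach \<Rightarrow> 'a" +
  assumes mul_of_real: "mul (of_real r) x = r *\<^sub>R x"
    and norm_mul: "norm (mul c x) = cmod c * norm x"

text \<open>The natural numbers start at \<open>0\<close> here, so the partial sum with index \<open>k\<close> is the one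
  over \<open>i \<le> k\<close>. A filter on \<open>\<nat>\<close>, as a family of sets, is the family
  of all \<open>A\<close> with \<open>\<forall>\<^sub>F k in F. k \<in> A\<close>.\<close>

definition filter_expansion ::
  "nat filter \<Rightarrow> ('k \<Rightarrow> 'a::real_normed_vector \<Rightarrow> 'a) \<Rightarrow> (nat \<Rightarrow> 'a) \<Rightarrow> 'a \<Rightarrow> (nat \<Rightarrow> 'k) \<Rightarrow> bool" where
  "filter_expansion F mul e x a \<longleftrightarrow> ((\<lambda>k. \<Sum>i\<le>k. mul (a i) (e i)) \<longlongrightarrow> x) F"

definition filter_basis ::
  "nat filter \<Rightarrow> ('k \<Rightarrow> 'a::real_normed_vector \<Rightarrow> 'a) \<Rightarrow> (nat \<Rightarrow> 'a) \<Rightarrow> bool" where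
  "filter_basis F mul e \<longleftrightarrow> (\<forall>x. \<exists>!a. filter_expansion F mul e x a)"

definition coord_functional ::
  "nat filter \<Rightarrow> ('k \<Rightarrow> 'a::real_normed_vector \<Rightarrow> 'a) \<Rightarrow> (nat \<Rightarrow> 'a) \<Rightarrow> nat \<Rightarrow> 'a \<Rightarrow> 'k" where
  "coord_functional F mul e k x = (THE a. filter_expansion F mul e x a) k"

end

theory Submission
  imports Defs
begin

text \<open>The coordinate functionals are linear, and a linear functional on a Banach space is
  continuous as soon as the sets \<open>{x. norm (f x) \<le> N}\<close> have the Baire property
  (\<open>continuous_if_Baire_measurable\<close>, an argument of Pettis: some of these sets is non-meagre, and
  then its difference set contains a ball). So it suffices that these sets are \<open>\<Delta>\<^sup>1\<^sub>n\<close>.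

  The reason is that the graph of \<open>x \<mapsto> (e\<^sub>k\<^sup>*(x))\<^sub>k\<close> is no more complicated than the filter. Indeed
  \<open>x\<close> is the sum of the series with coefficients \<open>a\<close> iff there are sets \<open>A\<^sub>0, A\<^sub>1, \<dots>\<close> in
  the filter such that for all \<open>m\<close> and all \<open>l \<in> A\<^sub>m\<close> the partial sum with index \<open>l\<close> has distance
  at most \<open>1/(m+1)\<close> from \<open>x\<close>. The last condition is closed in \<open>(x, a, (A\<^sub>m)\<^sub>m)\<close>, and \<open>a\<close> and
  \<open>(A\<^sub>m)\<^sub>m\<close> can be coded continuously by one point \<open>z\<close> of the Baire space. By uniqueness of the
  expansion, a condition on \<open>e\<^sub>k\<^sup>*(x)\<close> may be read as a condition on \<open>a\<^sub>k\<close> for some such \<open>z\<close>. Hence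
  both \<open>{x. norm (e\<^sub>k\<^sup>*(x)) \<le> N}\<close> and its complement are projections along the Baire space of a
  closed set intersected with countably many continuous preimages of the filter
  (\<open>Sigma1_coord_functional\<close>), and so they are \<open>\<Sigma>\<^sup>1\<^sub>n\<close>.

  Thus \<open>\<Sigma>\<^sup>1\<^sub>n\<close> has to be closed under continuous preimages, intersections with closed
  sets, projections along the Baire space, and countable intersections of preimages of one set:
  \<open>Sigma1_vimage\<close>, \<open>Sigma1_Int_closedin\<close>, \<open>Sigma1_projection\<close>, \<open>Sigma1_INT_vimage\<close>. All four rest on
  the fact that a nonempty Polish space is a continuous image of the Baire space
  (\<open>Polish_imp_baire_image\<close>). This fact also carries the assumption on Polish spaces, whose
  points lie in \<^typ>\<open>nat \<Rightarrow> nat\<close>, over to the Banach space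
  (\<open>Baire_measurable_if_Delta1\<close>).\<close>

section \<open>The Baire space\<close>

lemma baire_space_euclidean: "baire_space = euclidean"
proof -
  have "(discrete_topology UNIV :: nat topology) = euclidean"
    by (metis (mono_tags) discrete_topology_unique open_discrete open_openin topspace_euclidean)
  then show ?thesis
    by (simp add: euclidean_product_topology)
qed

lemma Polish_subtopology_baire:
  assumes "closedin baire_space K \<or> openin baire_space K"
  shows "Polish (subtopology baire_space K)"
proof -
  have "completely_metrizable_space baire_space"
    by (simp add: completely_metrizable_space_product_topology completely_metrizable_space_discrete_topology)
  then have "completely_metrizable_space (subtopology baire_space K)"
    using assms completely_metrizable_space_closedin completely_metrizable_space_openin by blast
  moreover have "second_countable (euclidean :: (nat \<Rightarrow> nat) topology)"
  proof -
    obtain B :: "(nat \<Rightarrow> nat) set set" where "countable B" "topological_basis B"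
      using ex_countable_basis by blast
    then show ?thesis
      unfolding second_countable_def by (metis open_openin topological_basisE topological_basis_open)
  qed
  then have "separable_space (subtopology baire_space K)"
    unfolding baire_space_euclidean
    by (intro second_countable_imp_separable_space second_countable_subtopology)
  ultimately show ?thesis
    by (simp add: Polish_def)
qed

lemma Polish_baire_space: "Polish baire_space"
  using Polish_subtopology_baire[of UNIV] by (simp add: openin_topspace[of baire_space, simplified])

lemma continuous_map_reindex: "continuous_map baire_space baire_space (\<lambda>z j. z (g j))"
  by (auto simp: continuous_map_componentwise_UNIV intro: continuous_map_product_projection)

text \<open>A choice among countably many continuous maps is continuous if it depends on a discrete parameter,
  since the domain splits into clopen pieces. Typically the parameter is a value of a point of the
  Baire space.\<close>

lemma continuous_map_discrete_case:
  assumes c: "continuous_map Y (discrete_topology UNIV) c" and h: "\<And>j. continuous_map Y Z (h j)"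
  shows "continuous_map Y Z (\<lambda>y. h (c y) y)"
  unfolding continuous_map_def
proof (intro conjI allI impI)
  show "(\<lambda>y. h (c y) y) \<in> topspace Y \<rightarrow> topspace Z"
    using h by (auto simp: continuous_map_def Pi_iff)
  fix U assume U: "openin Z U"
  have "{y \<in> topspace Y. h (c y) y \<in> U} =
      (\<Union>j. {y \<in> topspace Y. c y \<in> {j}} \<inter> {y \<in> topspace Y. h j y \<in> U})"
    by auto
  moreover have "openin Y {y \<in> topspace Y. c y \<in> {j}}" for j
    by (rule openin_continuous_map_preimage[OF c]) auto
  ultimately show "openin Y {y \<in> topspace Y. h (c y) y \<in> U}"
    using openin_continuous_map_preimage[OF h U] by (simp only:) (intro openin_Union, auto)
qed

text \<open>A quantifier over sequences of points of the Baire space becomes one over single points,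
  which are cut into columns.\<close>

definition column :: "nat \<Rightarrow> (nat \<Rightarrow> nat) \<Rightarrow> nat \<Rightarrow> nat" where
  "column m z = (\<lambda>k. z (prod_encode (m, k)))"

definition interleave :: "(nat \<Rightarrow> nat \<Rightarrow> nat) \<Rightarrow> nat \<Rightarrow> nat" where
  "interleave w = (\<lambda>j. case prod_decode j of (m, k) \<Rightarrow> w m k)"

lemma column_interleave [simp]: "column m (interleave w) = w m"
  by (auto simp: column_def interleave_def)

lemma continuous_map_column: "continuous_map baire_space baire_space (column m)"
  unfolding column_def by (rule continuous_map_reindex)

lemma continuous_map_digit: "continuous_map baire_space (discrete_topology UNIV) (\<lambda>z. z i)"
  by (rule continuous_map_product_projection) simp

definition tail :: "(nat \<Rightarrow> nat) \<Rightarrow> nat \<Rightarrow> nat" where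
  "tail z = (\<lambda>k. z (Suc k))"

lemma tail_case_nat [simp]: "tail (case_nat a z) = z"
  by (simp add: tail_def)

lemma continuous_map_tail: "continuous_map baire_space baire_space tail"
  unfolding tail_def by (rule continuous_map_reindex)

text \<open>A point \<open>z\<close> of the Baire space lists attempts \<open>D (z 0), D (z 1), \<dots>\<close> at approximating a point
  by elements of a dense sequence \<open>D\<close>. An attempt farther than \<open>(1/2)\<^sup>i\<close> from the current
  approximation is ignored. So every \<open>z\<close> yields a Cauchy sequence, with a rate of convergence that does not
  depend on \<open>z\<close>, which makes the limit continuous in \<open>z\<close>; and good attempts are never ignored, so
  every point is reached.\<close>

lemma Polish_imp_baire_image:
  assumes "Polish P" "topspace P \<noteq> {}"
  obtains f where "continuous_map baire_space P f" "f ` UNIV = topspace P"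
proof -
  obtain M d where "Metric_space M d" and complete: "Metric_space.mcomplete M d"
    and P: "P = Metric_space.mtopology M d"
    using assms(1) unfolding Polish_def completely_metrizable_space_def by blast
  interpret Metric_space M d by fact
  obtain S where S: "countable S" "S \<subseteq> M" "mtopology closure_of S = M"
    using assms(1) unfolding Polish_def separable_space_def P by auto
  have "S \<noteq> {}"
    using S assms(2) P by auto
  define D where "D = from_nat_into S"
  have D_M: "D i \<in> M" for i
    unfolding D_def using from_nat_into[OF \<open>S \<noteq> {}\<close>] S(2) by blast
  have dense: "\<exists>i. d x (D i) < r" if "x \<in> M" "r > 0" for x r
  proof -
    have "x \<in> mtopology closure_of S" using S that by simp
    then obtain y where "y \<in> S" "y \<in> mball x r"
      unfolding metric_closure_of using \<open>r > 0\<close> by auto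
    moreover obtain i where "y = D i"
      unfolding D_def using from_nat_into_surj[OF S(1) \<open>y \<in> S\<close>] by metis
    ultimately show ?thesis by auto
  qed
  define s where "s z = rec_nat (D (z 0))
      (\<lambda>i p. if d p (D (z (Suc i))) < (1/2)^i then D (z (Suc i)) else p)" for z
  have s_0: "s z 0 = D (z 0)" and
    s_Suc: "s z (Suc i) = (if d (s z i) (D (z (Suc i))) < (1/2)^i then D (z (Suc i)) else s z i)" for z i
    by (auto simp: s_def)
  have s_M: "s z i \<in> M" for z i
    by (induction i) (auto simp: s_0 s_Suc D_M)
  have step: "d (s z i) (s z (Suc i)) \<le> (1/2)^i" for z i
    using s_M by (auto simp: s_Suc)
  have drift: "d (s z i) (s z (i + j)) \<le> 2 * (1/2)^i - 2 * (1/2)^(i+j)" for z i j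
  proof (induction j)
    case (Suc j)
    have "d (s z i) (s z (i + Suc j)) \<le> d (s z i) (s z (i + j)) + d (s z (i + j)) (s z (Suc (i + j)))"
      using triangle s_M by simp
    with Suc step[of z "i+j"] show ?case by simp
  qed (use s_M in simp)
  have drift': "d (s z i) (s z j) \<le> 2 * (1/2)^i" if "i \<le> j" for z i j
  proof -
    have "2 * (1/2 :: real)^j \<ge> 0" by simp
    then show ?thesis using drift[of z i "j-i"] that by (simp only: le_add_diff_inverse)
  qed
  have small: "\<exists>i. 4 * (1/2 :: real)^i < e" if "e > 0" for e
    using real_arch_pow_inv[of "e/4" "1/2"] that by (auto simp: field_simps)
  have Cauchy: "MCauchy (s z)" for z
    unfolding MCauchy_def
  proof (intro conjI allI impI)
    fix e :: real assume "e > 0"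
    then obtain i where i: "4 * (1/2 :: real)^i < e" using small by blast
    show "\<exists>N. \<forall>n n'. N \<le> n \<longrightarrow> N \<le> n' \<longrightarrow> d (s z n) (s z n') < e"
    proof (intro exI allI impI)
      fix n n' assume "i \<le> n" "i \<le> n'"
      then have "d (s z i) (s z n) \<le> 2 * (1/2)^i" "d (s z i) (s z n') \<le> 2 * (1/2)^i"
        using drift' by blast+
      moreover have "d (s z n) (s z n') \<le> d (s z i) (s z n) + d (s z i) (s z n')"
        using triangle[of "s z n" "s z i" "s z n'"] s_M commute[of "s z n" "s z i"] by simp
      ultimately show "d (s z n) (s z n') < e" using i by linarith
    qed
  qed (use s_M in auto)
  then have "\<exists>x. limitin mtopology (s z) x sequentially" for z
    using complete unfolding mcomplete_def by blast
  then obtain l where l: "limitin mtopology (s z) (l z) sequentially" for z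
    by metis
  have l_M: "l z \<in> M" for z
    using l limitin_mspace by blast
  have l_dist: "d (s z i) (l z) \<le> 2 * (1/2)^i" for z i
  proof (rule field_le_epsilon)
    fix e :: real assume "e > 0"
    then have "\<forall>\<^sub>F j in sequentially. d (s z j) (l z) < e"
      using l[of z] by (force simp: limitin_metric elim: eventually_mono)
    then obtain N where "\<forall>j\<ge>N. d (s z j) (l z) < e"
      unfolding eventually_sequentially by blast
    then obtain j where j: "j \<ge> i" "d (s z j) (l z) < e"
      using max.cobounded1[of i N] max.cobounded2[of N i] by blast
    have "d (s z i) (l z) \<le> d (s z i) (s z j) + d (s z j) (l z)"
      using triangle s_M l_M by blast
    with j drift'[OF j(1), of z] show "d (s z i) (l z) \<le> 2 * (1/2)^i + e" by linarith
  qed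
  have agree: "s z i = s z' i" if "\<forall>j\<le>i. z j = z' j" for z z' i
    using that by (induction i) (auto simp: s_0 s_Suc)
  have "continuous_map baire_space mtopology l"
    unfolding continuous_map_to_metric
  proof (intro ballI allI impI)
    fix z :: "nat \<Rightarrow> nat" and e :: real assume "e > 0"
    then obtain i where i: "4 * (1/2 :: real)^i < e" using small by blast
    let ?U = "Pi\<^sub>E UNIV (\<lambda>j. if j \<le> i then {z j} else UNIV)"
    have "openin baire_space ?U"
      by (rule product_topology_basis) (auto intro: finite_subset[of _ "{..i}"])
    moreover have "l z' \<in> mball (l z) e" if "z' \<in> ?U" for z'
    proof -
      have "\<forall>j\<le>i. z j = z' j"
        using that by (fastforce simp: PiE_def Pi_iff split: if_splits)
      then have "s z i = s z' i" by (rule agree)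
      then have "d (l z) (l z') \<le> d (s z i) (l z) + d (s z' i) (l z')"
        using triangle[of "l z" "s z i" "l z'"] l_M s_M commute[of "l z" "s z i"] by simp
      also have "\<dots> < e" using l_dist[of z i] l_dist[of z' i] i by linarith
      finally show ?thesis using l_M by simp
    qed
    ultimately show "\<exists>U. openin baire_space U \<and> z \<in> U \<and> (\<forall>z'\<in>U. l z' \<in> mball (l z) e)"
      by (intro exI[of _ ?U]) auto
  qed
  moreover have "l ` UNIV = M"
  proof (intro set_eqI iffI)
    fix x assume x: "x \<in> M"
    have "\<exists>k. d x (D k) < (1/2)^(i+2)" for i
      using dense[OF x, of "(1/2)^(i+2)"] by simp
    then obtain z where z: "d x (D (z i)) < (1/2)^(i+2)" for i
      by metis
    have s_D: "s z i = D (z i)" for i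
    proof (induction i)
      case (Suc i)
      have "d (D (z i)) (D (z (Suc i))) \<le> d x (D (z i)) + d x (D (z (Suc i)))"
        using triangle[of "D (z i)" x "D (z (Suc i))"] D_M x commute[of "D (z i)" x] by simp
      also have "\<dots> < (1/2)^(i+2) + (1/2)^(Suc i+2)"
        using z[of i] z[of "Suc i"] by linarith
      also have "\<dots> \<le> (1/2)^i"
        by simp
      finally show ?case using Suc by (simp add: s_Suc)
    qed (simp add: s_0)
    have "d x (l z) \<le> e" if "e > 0" for e
    proof -
      obtain i where i: "4 * (1/2 :: real)^i < e" using small \<open>e > 0\<close> by blast
      have "d x (l z) \<le> d x (s z i) + d (s z i) (l z)"
        using triangle x s_M l_M by blast
      moreover have "(1/2 :: real)^(i+2) \<le> (1/2)^i" "(1/2 :: real)^i > 0" by simp_all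
      ultimately show ?thesis using l_dist[of z i] z[of i] i unfolding s_D by linarith
    qed
    then have "d x (l z) = 0"
      using nonneg by (meson dense_ge antisym)
    then show "x \<in> range l" using x l_M by (metis rangeI zero)
  qed (use l_M in auto)
  ultimately show thesis using that P by auto
qed

section \<open>Analytic sets\<close>

text \<open>Here the Polish space in the definition of analytic sets becomes a fixed one. In what follows
  the source is always the Baire space or a closed or open part of it.\<close>

lemma analytic_in_iff_baire_image:
  assumes "A \<noteq> {}"
  shows "analytic_in X A \<longleftrightarrow> (\<exists>f. continuous_map baire_space X f \<and> range f = A)"
proof
  assume "analytic_in X A"
  then obtain P :: "(nat \<Rightarrow> nat) topology" and f
    where P: "Polish P" and f: "continuous_map P X f" "f ` topspace P = A"
    using assms unfolding analytic_in_def by blast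
  then have "topspace P \<noteq> {}" using assms by auto
  then obtain g where g: "continuous_map baire_space P g" "range g = topspace P"
    using Polish_imp_baire_image[OF P] by blast
  have "continuous_map baire_space X (f \<circ> g)" "range (f \<circ> g) = A"
    using continuous_map_compose[OF g(1) f(1)] f(2) g(2) by (metis, metis image_comp)
  then show "\<exists>f. continuous_map baire_space X f \<and> range f = A" by blast
next
  assume "\<exists>f. continuous_map baire_space X f \<and> range f = A"
  then show "analytic_in X A"
    unfolding analytic_in_def using Polish_baire_space by fastforce
qed

lemma analytic_in_image_subset_baire:
  assumes "closedin baire_space K \<or> openin baire_space K" "continuous_map baire_space X f"
  shows "analytic_in X (f ` K)"
proof -
  have "continuous_map (subtopology baire_space K) X f"
    using assms(2) by (rule continuous_map_from_subtopology)
  moreover have "f ` topspace (subtopology baire_space K) = f ` K"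
    by simp
  ultimately show ?thesis
    unfolding analytic_in_def using Polish_subtopology_baire[OF assms(1)] by blast
qed

text \<open>The preimage is the projection of the fibre product of \<open>Y\<close> and the space mapped onto \<open>A\<close>. Assuming
  only that \<open>Y\<close> is analytic in itself, rather than Polish, allows the fibre product to be formed from
  codes for the points of \<open>Y\<close>, as a closed subset of the Baire space; and this assumption passes to the products
  \<open>times_baire Y m\<close> without any work on complete metrics.\<close>

lemma analytic_in_vimage:
  assumes Y: "analytic_in Y (topspace Y)" and Z: "Hausdorff_space Z"
    and A: "analytic_in Z A" and h: "continuous_map Y Z h"
  shows "analytic_in Y {y \<in> topspace Y. h y \<in> A}"
proof (cases "A = {} \<or> topspace Y = {}")
  case True
  then show ?thesis by (auto simp: analytic_in_def)
next
  case False
  then obtain f g where f: "continuous_map baire_space Z f" "range f = A"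
    and g: "continuous_map baire_space Y g" "range g = topspace Y"
    using A Y by (metis analytic_in_iff_baire_image)
  have c: "continuous_map baire_space Y (\<lambda>w. g (column 0 w))"
    using continuous_map_compose[OF continuous_map_column g(1)] by (simp add: o_def)
  have "continuous_map baire_space Z (\<lambda>w. h (g (column 0 w)))"
    using continuous_map_compose[OF c h] by (simp add: o_def)
  moreover have "continuous_map baire_space Z (\<lambda>w. f (column 1 w))"
    using continuous_map_compose[OF continuous_map_column f(1)] by (simp add: o_def)
  ultimately have "closedin baire_space {w \<in> topspace baire_space. h (g (column 0 w)) = f (column 1 w)}"
    by (rule closedin_continuous_maps_eq[OF Z])
  then have "analytic_in Y ((\<lambda>w. g (column 0 w)) ` {w. h (g (column 0 w)) = f (column 1 w)})"
    using c by (intro analytic_in_image_subset_baire) auto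
  also have "(\<lambda>w. g (column 0 w)) ` {w. h (g (column 0 w)) = f (column 1 w)} = {y \<in> topspace Y. h y \<in> A}"
  proof (intro subset_antisym subsetI)
    fix y assume "y \<in> {y \<in> topspace Y. h y \<in> A}"
    then have "y \<in> range g" "h y \<in> range f"
      using f(2) g(2) by auto
    then obtain u v where "y = g u" "h y = f v"
      by blast
    then show "y \<in> (\<lambda>w. g (column 0 w)) ` {w. h (g (column 0 w)) = f (column 1 w)}"
      by (intro image_eqI[of _ _ "interleave (case_nat u (\<lambda>_. v))"]) auto
  qed (use f(2) g(2) in auto)
  finally show ?thesis .
qed

lemma analytic_in_Int_closedin:
  assumes "analytic_in Y A" "closedin Y C"
  shows "analytic_in Y (A \<inter> C)"
proof (cases "A = {}")
  case False
  then obtain f where f: "continuous_map baire_space Y f" "range f = A"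
    using assms by (metis analytic_in_iff_baire_image)
  have "closedin baire_space {w \<in> topspace baire_space. f w \<in> C}"
    using closedin_continuous_map_preimage f(1) assms(2) by blast
  then have "analytic_in Y (f ` {w \<in> topspace baire_space. f w \<in> C})"
    using f(1) by (blast intro: analytic_in_image_subset_baire)
  also have "f ` {w \<in> topspace baire_space. f w \<in> C} = A \<inter> C"
    using f(2) by auto
  finally show ?thesis .
qed (simp add: analytic_in_def)

lemma analytic_in_Un:
  assumes "analytic_in Y A" "analytic_in Y B"
  shows "analytic_in Y (A \<union> B)"
proof (cases "A = {} \<or> B = {}")
  case False
  then obtain f g where f: "continuous_map baire_space Y f" "range f = A"
    and g: "continuous_map baire_space Y g" "range g = B"
    using assms by (metis analytic_in_iff_baire_image)
  define F where "F w = (if w 0 = 0 then f (tail w) else g (tail w))" for w :: "nat \<Rightarrow> nat"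
  have "continuous_map baire_space Y (\<lambda>w. f (tail w))" "continuous_map baire_space Y (\<lambda>w. g (tail w))"
    using continuous_map_compose[OF continuous_map_tail] f(1) g(1) by (auto simp: o_def)
  then have "continuous_map baire_space Y F"
    unfolding F_def
    using continuous_map_discrete_case[OF continuous_map_digit[of 0],
        of Y "\<lambda>j w. if j = 0 then f (tail w) else g (tail w)"]
    by auto
  moreover have "range F = A \<union> B"
  proof -
    have "f z = F (case_nat 0 z)" "g z = F (case_nat 1 z)" for z
      by (auto simp: F_def)
    then have "A \<union> B \<subseteq> range F" using f(2) g(2) by blast
    then show ?thesis using f(2) g(2) by (auto simp: F_def)
  qed
  ultimately show ?thesis
    using False by (subst analytic_in_iff_baire_image) auto
qed (use assms in auto)

lemma analytic_in_openin:
  assumes Y: "analytic_in Y (topspace Y)" and U: "openin Y U"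
  shows "analytic_in Y U"
proof (cases "U = {}")
  case False
  then have "topspace Y \<noteq> {}" using openin_subset[OF U] by auto
  then obtain f where f: "continuous_map baire_space Y f" "range f = topspace Y"
    using Y by (metis analytic_in_iff_baire_image)
  have "openin baire_space {w \<in> topspace baire_space. f w \<in> U}"
    using openin_continuous_map_preimage f(1) U by blast
  then have "analytic_in Y (f ` {w \<in> topspace baire_space. f w \<in> U})"
    using f(1) by (blast intro: analytic_in_image_subset_baire)
  also have "f ` {w \<in> topspace baire_space. f w \<in> U} = U"
    using f(2) openin_subset[OF U] by auto
  finally show ?thesis .
qed (simp add: analytic_in_def)

lemma analytic_in_topspace_times_baire:
  assumes Y: "analytic_in Y (topspace Y)"
  shows "analytic_in (times_baire Y m) (topspace (times_baire Y m))"
proof (cases "topspace Y = {}")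
  case True
  then show ?thesis by (simp add: topspace_times_baire analytic_in_def)
next
  case False
  then obtain g where g: "continuous_map baire_space Y g" "range g = topspace Y"
    using Y by (metis analytic_in_iff_baire_image)
  define F where "F w = (g (column 0 w), \<lambda>i\<in>{..<m}. column (Suc i) w)" for w
  have "continuous_map baire_space Y (\<lambda>w. g (column 0 w))"
    using continuous_map_compose[OF continuous_map_column g(1)] by (simp add: o_def)
  moreover have "continuous_map baire_space (product_topology (\<lambda>_. baire_space) {..<m})
      (\<lambda>w. \<lambda>i\<in>{..<m}. column (Suc i) w)"
    unfolding continuous_map_componentwise[of _ "\<lambda>_. baire_space"]
    using continuous_map_column by auto
  ultimately have "continuous_map baire_space (times_baire Y m) F"
    unfolding F_def times_baire_def by (intro continuous_map_pairedI)
  moreover have "range F = topspace (times_baire Y m)"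
  proof (intro subset_antisym subsetI)
    fix x assume "x \<in> topspace (times_baire Y m)"
    then obtain y f where "y \<in> range g" "x = (y, f)" "f \<in> extensional {..<m}"
      using g(2) by (auto simp: topspace_times_baire)
    then obtain u where x: "x = (g u, f)" "f \<in> extensional {..<m}"
      by blast
    then have "x = F (interleave (case_nat u f))"
      by (auto simp: F_def extensional_def fun_eq_iff)
    then show "x \<in> range F" by blast
  qed (use g(2) in \<open>auto simp: F_def topspace_times_baire\<close>)
  ultimately have "\<exists>f. continuous_map baire_space (times_baire Y m) f \<and> range f = topspace (times_baire Y m)"
    by blast
  moreover have "topspace (times_baire Y m) \<noteq> {}"
    using \<open>range F = _\<close> by (metis empty_not_UNIV image_is_empty)
  ultimately show ?thesis
    by (simp only: analytic_in_iff_baire_image not_False_eq_True)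
qed

lemma analytic_in_topspace_prod_baire:
  assumes "analytic_in Y (topspace Y)"
  shows "analytic_in (prod_topology Y baire_space) (topspace (prod_topology Y baire_space))"
proof -
  have "analytic_in (times_baire Y 1) (topspace (times_baire Y 1))"
    using assms by (rule analytic_in_topspace_times_baire)
  then have "analytic_in (times_baire (prod_topology Y baire_space) 0)
      (regroup 0 ` topspace (times_baire Y (Suc 0)))"
    using analytic_in_continuous_image[OF _ continuous_map_regroup[of Y 0]] by simp
  then have "analytic_in (prod_topology Y baire_space)
      (fst ` topspace (times_baire (prod_topology Y baire_space) 0))"
    unfolding regroup_image
    by (rule analytic_in_continuous_image) (simp add: times_baire_def continuous_map_fst)
  then show ?thesis
    by (simp add: topspace_times_baire)
qed

lemma Hausdorff_times_baire:
  "Hausdorff_space Z \<Longrightarrow> Hausdorff_space (times_baire Z m)"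
  by (simp add: times_baire_def Hausdorff_space_prod_topology Hausdorff_space_product_topology)

section \<open>Closure properties of the projective classes\<close>

text \<open>The projection in the recursion that defines the projective classes.\<close>

definition forget :: "nat \<Rightarrow> 'a \<times> (nat \<Rightarrow> nat \<Rightarrow> nat) \<Rightarrow> 'a \<times> (nat \<Rightarrow> nat \<Rightarrow> nat)" where
  "forget m = (\<lambda>(y, f). (y, restrict f {..<m}))"

lemma continuous_map_times_baire_component:
  "i < m \<Longrightarrow> continuous_map (times_baire Y m) baire_space (\<lambda>x. snd x i)"
  using continuous_map_compose[OF continuous_map_snd
      continuous_map_product_projection[of i "{..<m}" "\<lambda>_. baire_space"], of Y]
  by (simp add: o_def times_baire_def)

lemma continuous_map_into_times_baire:
  assumes "continuous_map X Y f" "\<And>i. i < m \<Longrightarrow> continuous_map X baire_space (\<lambda>x. g x i)"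
  shows "continuous_map X (times_baire Y m) (\<lambda>x. (f x, \<lambda>i\<in>{..<m}. g x i))"
proof -
  have "continuous_map X (product_topology (\<lambda>_. baire_space) {..<m}) (\<lambda>x. \<lambda>i\<in>{..<m}. g x i)"
    unfolding continuous_map_componentwise[of _ "\<lambda>_. baire_space"]
    using assms(2) by auto
  with assms(1) show ?thesis
    unfolding times_baire_def by (intro continuous_map_pairedI)
qed

lemma continuous_map_times_baire_fst: "continuous_map (times_baire Y m) Y fst"
  by (simp add: times_baire_def continuous_map_fst)

lemma continuous_map_forget: "continuous_map (times_baire Y (Suc m)) (times_baire Y m) (forget m)"
proof -
  have eq: "forget m = (\<lambda>x. (fst x, \<lambda>i\<in>{..<m}. snd x i))"
    by (auto simp: forget_def)
  show ?thesis
    unfolding eq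
    by (intro continuous_map_into_times_baire continuous_map_times_baire_fst
        continuous_map_times_baire_component) simp
qed

lemma forget_image: "forget m ` topspace (times_baire Y (Suc m)) = topspace (times_baire Y m)"
proof (intro subset_antisym subsetI)
  fix x assume "x \<in> topspace (times_baire Y m)"
  then obtain y f where x: "x = (y, f)" "y \<in> topspace Y" "f \<in> extensional {..<m}"
    by (auto simp: topspace_times_baire)
  then have "x = forget m (y, f(m := \<lambda>_. 0))"
    by (auto simp: forget_def extensional_def fun_eq_iff)
  moreover have "(y, f(m := \<lambda>_. 0)) \<in> topspace (times_baire Y (Suc m))"
    using x by (auto simp: topspace_times_baire extensional_def)
  ultimately show "x \<in> forget m ` topspace (times_baire Y (Suc m))" by blast
qed (auto simp: topspace_times_baire forget_def)

lemma Sigma1_times_Suc_iff: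
  assumes "n > 0"
  shows "Sigma1_times (Suc n) Y m A \<longleftrightarrow>
     (\<exists>B \<subseteq> topspace (times_baire Y (Suc m)).
        Sigma1_times n Y (Suc m) (topspace (times_baire Y (Suc m)) - B) \<and> A = forget m ` B)"
  using assms by (cases n) (simp_all add: forget_def)

lemma Sigma1_times_SucI:
  assumes "n > 0" "B \<subseteq> topspace (times_baire Y (Suc m))"
    "Sigma1_times n Y (Suc m) (topspace (times_baire Y (Suc m)) - B)" "A = forget m ` B"
  shows "Sigma1_times (Suc n) Y m A"
  unfolding Sigma1_times_Suc_iff[OF assms(1)] using assms(2-4) by (intro exI[of _ B] conjI)

text \<open>A continuous map \<open>h\<close> extends to the next level by acting as the identity on the new coordinate,
  which moves from position \<open>m\<close> to position \<open>m'\<close>. Preimages under this extension commute with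
  complements and projections, so the induction reduces to analytic sets. It has to run over
  all \<open>m\<close>, \<open>m'\<close> and \<open>h\<close> at once.\<close>

lemma Sigma1_times_vimage:
  fixes Y :: "'a topology" and Z :: "'b topology"
  assumes Y: "analytic_in Y (topspace Y)" and Z: "Hausdorff_space Z"
    and "continuous_map (times_baire Y m) (times_baire Z m') h" "Sigma1_times n Z m' A"
  shows "Sigma1_times n Y m {x \<in> topspace (times_baire Y m). h x \<in> A}"
  using assms(3,4)
proof (induction n arbitrary: m m' h A)
  case (Suc n)
  show ?case
  proof (cases "n > 0")
    case False
    then show ?thesis
      using Suc.prems analytic_in_vimage[OF analytic_in_topspace_times_baire[OF Y] Hausdorff_times_baire[OF Z]]
      by simp
  next
    case True
    let ?T = "topspace (times_baire Y (Suc m))" and ?T' = "topspace (times_baire Z (Suc m'))"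
    obtain B where B: "B \<subseteq> ?T'" "Sigma1_times n Z (Suc m') (?T' - B)" "A = forget m' ` B"
      using Suc.prems(2) unfolding Sigma1_times_Suc_iff[OF True] by blast
    define H where "H x = (fst (h (forget m x)),
        \<lambda>i\<in>{..<Suc m'}. if i < m' then snd (h (forget m x)) i else snd x m)"
      for x :: "'a \<times> (nat \<Rightarrow> nat \<Rightarrow> nat)"
    have hf: "continuous_map (times_baire Y (Suc m)) (times_baire Z m') (\<lambda>x. h (forget m x))"
      using continuous_map_compose[OF continuous_map_forget Suc.prems(1)] by (simp add: o_def)
    have H: "continuous_map (times_baire Y (Suc m)) (times_baire Z (Suc m')) H"
      unfolding H_def
    proof (rule continuous_map_into_times_baire)
      show "continuous_map (times_baire Y (Suc m)) Z (\<lambda>x. fst (h (forget m x)))"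
        using continuous_map_compose[OF hf continuous_map_times_baire_fst] by (simp add: o_def)
      show "continuous_map (times_baire Y (Suc m)) baire_space
          (\<lambda>x. if i < m' then snd (h (forget m x)) i else snd x m)" for i
        using continuous_map_compose[OF hf continuous_map_times_baire_component[of i m' Z]]
          continuous_map_times_baire_component[of m "Suc m" Y]
        by (cases "i < m'") (auto simp: o_def)
    qed
    have H_T: "H x \<in> ?T'" if "x \<in> ?T" for x
      using continuous_map_image_subset_topspace[OF H] that by blast
    have h_T: "h x \<in> topspace (times_baire Z m')" if "x \<in> topspace (times_baire Y m)" for x
      using continuous_map_image_subset_topspace[OF Suc.prems(1)] that by blast
    have forget_H: "forget m' (H x) = h (forget m x)" if "x \<in> ?T" for x
    proof -
      have "h (forget m x) \<in> topspace (times_baire Z m')"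
        using that forget_image[of m Y] h_T by blast
      then show ?thesis
        by (cases "h (forget m x)")
          (auto simp: H_def forget_def topspace_times_baire extensional_def fun_eq_iff)
    qed
    have "?T - {x \<in> ?T. H x \<in> B} = {x \<in> ?T. H x \<in> ?T' - B}"
      using H_T by blast
    then have "Sigma1_times n Y (Suc m) (?T - {x \<in> ?T. H x \<in> B})"
      using Suc.IH[OF H B(2)] by simp
    moreover have "{x \<in> topspace (times_baire Y m). h x \<in> A} = forget m ` {x \<in> ?T. H x \<in> B}"
    proof (intro subset_antisym subsetI)
      fix x assume "x \<in> {x \<in> topspace (times_baire Y m). h x \<in> A}"
      then obtain b where x: "x \<in> topspace (times_baire Y m)" and b: "b \<in> B" "h x = forget m' b"
        using B(3) by blast
      define x' where "x' = (fst x, (snd x)(m := snd b m'))"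
      have x': "x' \<in> ?T" "forget m x' = x"
        using x by (auto simp: x'_def topspace_times_baire forget_def extensional_def fun_eq_iff)
      have "b \<in> ?T'" using b B by blast
      then have "H x' = b"
        using x' b(2) by (cases b)
          (auto simp: H_def forget_def topspace_times_baire extensional_def fun_eq_iff less_Suc_eq x'_def)
      then show "x \<in> forget m ` {x \<in> ?T. H x \<in> B}"
        using x' b by blast
    next
      fix x assume "x \<in> forget m ` {x \<in> ?T. H x \<in> B}"
      then obtain x' where x': "x' \<in> ?T" "H x' \<in> B" "x = forget m x'" by blast
      then show "x \<in> {x \<in> topspace (times_baire Y m). h x \<in> A}"
        using forget_image[of m Y] forget_H[of x'] B(3) by (metis (mono_tags, lifting) imageI mem_Collect_eq)
    qed
    ultimately show ?thesis
      by (intro Sigma1_times_SucI[OF True, of "{x \<in> ?T. H x \<in> B}"]) auto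
  qed
qed simp

text \<open>The two claims are proved together because complementation in the recursion exchanges them.\<close>

lemma Sigma1_times_Int_closedin_Un_openin:
  fixes Y :: "'a topology"
  assumes Y: "analytic_in Y (topspace Y)" and "Sigma1_times n Y m A"
  shows "(closedin (times_baire Y m) C \<longrightarrow> Sigma1_times n Y m (A \<inter> C)) \<and>
         (openin (times_baire Y m) U \<longrightarrow> Sigma1_times n Y m (A \<union> U))"
  using assms(2)
proof (induction n arbitrary: m A C U)
  case (Suc n)
  show ?case
  proof (cases "n > 0")
    case False
    then show ?thesis
      using Suc.prems analytic_in_Int_closedin[of "times_baire Y m" A]
        analytic_in_Un[of "times_baire Y m" A U]
        analytic_in_openin[OF analytic_in_topspace_times_baire[OF Y], of m U] by simp
  next
    case True
    let ?T = "topspace (times_baire Y (Suc m))"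
    obtain B where B: "B \<subseteq> ?T" "Sigma1_times n Y (Suc m) (?T - B)" "A = forget m ` B"
      using Suc.prems unfolding Sigma1_times_Suc_iff[OF True] by blast
    note sub = forget_image[of m Y]
    show ?thesis
    proof (intro conjI impI)
      assume C: "closedin (times_baire Y m) C"
      have "openin (times_baire Y (Suc m)) {x \<in> ?T. forget m x \<in> topspace (times_baire Y m) - C}"
        using C by (intro openin_continuous_map_preimage[OF continuous_map_forget]) blast
      then have "Sigma1_times n Y (Suc m) ((?T - B) \<union> {x \<in> ?T. forget m x \<in> topspace (times_baire Y m) - C})"
        using Suc.IH[OF B(2)] by blast
      also have "(?T - B) \<union> {x \<in> ?T. forget m x \<in> topspace (times_baire Y m) - C} =
          ?T - {x \<in> B. forget m x \<in> C}"
        using B(1) sub by blast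
      finally have "Sigma1_times n Y (Suc m) (?T - {x \<in> B. forget m x \<in> C})" .
      moreover have "A \<inter> C = forget m ` {x \<in> B. forget m x \<in> C}"
        using B(3) by blast
      moreover have "{x \<in> B. forget m x \<in> C} \<subseteq> ?T" using B(1) by blast
      ultimately show "Sigma1_times (Suc n) Y m (A \<inter> C)"
        by (intro Sigma1_times_SucI[OF True, of "{x \<in> B. forget m x \<in> C}"])
    next
      assume U: "openin (times_baire Y m) U"
      have "closedin (times_baire Y (Suc m)) {x \<in> ?T. forget m x \<in> topspace (times_baire Y m) - U}"
        using U by (intro closedin_continuous_map_preimage[OF continuous_map_forget]) blast
      then have "Sigma1_times n Y (Suc m) ((?T - B) \<inter> {x \<in> ?T. forget m x \<in> topspace (times_baire Y m) - U})"
        using Suc.IH[OF B(2)] by blast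
      also have "(?T - B) \<inter> {x \<in> ?T. forget m x \<in> topspace (times_baire Y m) - U} =
          ?T - (B \<union> {x \<in> ?T. forget m x \<in> U})"
        using B(1) sub by blast
      finally have "Sigma1_times n Y (Suc m) (?T - (B \<union> {x \<in> ?T. forget m x \<in> U}))" .
      moreover have "A \<union> U = forget m ` (B \<union> {x \<in> ?T. forget m x \<in> U})"
      proof -
        have "U \<subseteq> topspace (times_baire Y m)" by (rule openin_subset[OF U])
        then have "forget m ` {x \<in> ?T. forget m x \<in> U} = U" using sub by fastforce
        then show ?thesis by (simp only: image_Un B(3))
      qed
      moreover have "B \<union> {x \<in> ?T. forget m x \<in> U} \<subseteq> ?T" using B(1) by blast
      ultimately show "Sigma1_times (Suc n) Y m (A \<union> U)"
        by (intro Sigma1_times_SucI[OF True, of "B \<union> {x \<in> ?T. forget m x \<in> U}"])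
    qed
  qed
qed simp

lemma Sigma1_vimage:
  assumes Y: "analytic_in Y (topspace Y)" and Z: "Hausdorff_space Z"
    and h: "continuous_map Y Z h" and A: "Sigma1 n Z A"
  shows "Sigma1 n Y {y \<in> topspace Y. h y \<in> A}"
proof -
  define H where "H x = (h (fst x), (\<lambda>_. undefined) :: nat \<Rightarrow> nat \<Rightarrow> nat)"
    for x :: "'a \<times> (nat \<Rightarrow> nat \<Rightarrow> nat)"
  have "continuous_map (times_baire Y 0) Z (\<lambda>x. h (fst x))"
    using continuous_map_compose[OF continuous_map_times_baire_fst h] by (simp add: o_def)
  from continuous_map_into_times_baire[OF this, of 0 undefined]
  have "continuous_map (times_baire Y 0) (times_baire Z 0) H"
    by (simp add: H_def[abs_def] restrict_def)
  from Sigma1_times_vimage[OF Y Z this A[unfolded Sigma1_def]]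
  have "Sigma1_times n Y 0 {x \<in> topspace (times_baire Y 0). H x \<in> A \<times> {\<lambda>_. undefined}}" .
  also have "{x \<in> topspace (times_baire Y 0). H x \<in> A \<times> {\<lambda>_. undefined}} =
      {y \<in> topspace Y. h y \<in> A} \<times> {\<lambda>_. undefined}"
    by (auto simp: topspace_times_baire H_def)
  finally show ?thesis by (simp add: Sigma1_def)
qed

lemma Sigma1_Int_closedin:
  assumes Y: "analytic_in Y (topspace Y)" and A: "Sigma1 n Y A" and C: "closedin Y C"
  shows "Sigma1 n Y (A \<inter> C)"
proof -
  have "closedin (times_baire Y 0) {x \<in> topspace (times_baire Y 0). fst x \<in> C}"
    by (rule closedin_continuous_map_preimage[OF continuous_map_times_baire_fst C])
  then have "Sigma1_times n Y 0
      (A \<times> {\<lambda>_. undefined} \<inter> {x \<in> topspace (times_baire Y 0). fst x \<in> C})"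
    using Sigma1_times_Int_closedin_Un_openin[OF Y A[unfolded Sigma1_def]] by blast
  also have "A \<times> {\<lambda>_. undefined} \<inter> {x \<in> topspace (times_baire Y 0). fst x \<in> C} =
      (A \<inter> C) \<times> {\<lambda>_. undefined}"
    using closedin_subset[OF C] by (auto simp: topspace_times_baire)
  finally show ?thesis by (simp add: Sigma1_def)
qed

lemma Pi1_vimage:
  assumes Y: "analytic_in Y (topspace Y)" and Z: "Hausdorff_space Z"
    and h: "continuous_map Y Z h" and A: "Pi1 n Z A"
  shows "Pi1 n Y {y \<in> topspace Y. h y \<in> A}"
proof -
  have "topspace Y - {y \<in> topspace Y. h y \<in> A} = {y \<in> topspace Y. h y \<in> topspace Z - A}"
    using continuous_map_image_subset_topspace[OF h] by blast
  then show ?thesis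
    using Sigma1_vimage[OF Y Z h, of n "topspace Z - A"] A by (simp add: Pi1_def)
qed

text \<open>Two successive projections along the Baire space are merged into one along its square, which is
  coded by the columns of a single point.\<close>

lemma Sigma1_projection:
  fixes Y :: "'a topology"
  assumes Y: "analytic_in Y (topspace Y)" "Hausdorff_space Y"
    and D: "Sigma1 n (prod_topology Y baire_space) D"
  shows "Sigma1 n Y (fst ` D)"
proof -
  let ?YN = "prod_topology Y baire_space"
  consider "n = 0" | "n = 1" | k where "n = Suc k" "k \<ge> 1"
    by (cases n) force+
  then show ?thesis
  proof cases
    case 1
    then show ?thesis using D by (simp add: Sigma1_def)
  next
    case 2
    then have "analytic_in ?YN D"
      using D Sigma1_1 by metis
    from analytic_in_continuous_image[OF this continuous_map_fst]
    show ?thesis unfolding 2 Sigma1_1 .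
  next
    case 3
    obtain B where B: "Pi1 k (prod_topology ?YN baire_space) B" "D = fst ` B"
      using D unfolding 3 Sigma1_Suc[OF 3(2)] by blast
    define H where "H x = ((fst x, column 0 (snd x)), column 1 (snd x))"
      for x :: "'a \<times> (nat \<Rightarrow> nat)"
    have col: "continuous_map ?YN baire_space (\<lambda>x. column i (snd x))" for i
      using continuous_map_compose[OF continuous_map_snd continuous_map_column] by (simp add: o_def)
    have H: "continuous_map ?YN (prod_topology ?YN baire_space) H"
      unfolding H_def by (intro continuous_map_pairedI continuous_map_fst col)
    have "Hausdorff_space (prod_topology ?YN baire_space)"
      using Y(2) by (simp add: Hausdorff_space_prod_topology Hausdorff_space_product_topology)
    from Pi1_vimage[OF analytic_in_topspace_prod_baire[OF Y(1)] this H B(1)]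
    have "Pi1 k ?YN {x \<in> topspace ?YN. H x \<in> B}" .
    moreover have "fst ` D = fst ` {x \<in> topspace ?YN. H x \<in> B}"
    proof (intro subset_antisym subsetI)
      fix y assume "y \<in> fst ` D"
      then obtain u v where b: "((y, u), v) \<in> B" using B(2) by auto
      then have "y \<in> topspace Y"
        using B(1) by (auto simp: Pi1_def)
      moreover have "H (y, interleave (case_nat u (\<lambda>_. v))) = ((y, u), v)"
        by (simp add: H_def)
      ultimately show "y \<in> fst ` {x \<in> topspace ?YN. H x \<in> B}"
        using b by (intro image_eqI[of _ _ "(y, interleave (case_nat u (\<lambda>_. v)))"]) auto
    qed (use B(2) in \<open>force simp: H_def\<close>)
    ultimately show ?thesis
      unfolding 3(1) Sigma1_Suc[OF 3(2)] by blast
  qed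
qed

text \<open>If \<open>A\<close> is the projection of \<open>B\<close>, then countably many witnesses, one for each \<open>m\<close>, form a single point
  of the Baire space, and so the countable intersection moves inside the projection. There its complement is
  a countable union of preimages of one set, which is a preimage followed by a projection along the index.
  For
  analytic \<open>A\<close> the corresponding set inside the projection is closed.\<close>

lemma Sigma1_INT_vimage:
  fixes Y :: "'a topology" and Z :: "'b topology"
  assumes Y: "analytic_in Y (topspace Y)" "Hausdorff_space Y" and Z: "Hausdorff_space Z"
    and h: "\<And>m :: nat. continuous_map Y Z (h m)" and A: "Sigma1 n Z A"
  shows "Sigma1 n Y {y \<in> topspace Y. \<forall>m. h m y \<in> A}"
proof -
  let ?YN = "prod_topology Y baire_space" and ?ZN = "prod_topology Z baire_space"
  have YN: "analytic_in ?YN (topspace ?YN)" "Hausdorff_space ?YN"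
    using Y by (auto simp: Hausdorff_space_prod_topology Hausdorff_space_product_topology
        intro: analytic_in_topspace_prod_baire simp del: topspace_prod_topology)
  have h_fst: "continuous_map ?YN Z (\<lambda>x. h m (fst x))" for m
    using continuous_map_compose[OF continuous_map_fst h] by (simp add: o_def)
  have col: "continuous_map ?YN baire_space (\<lambda>x. column m (snd x))" for m
    using continuous_map_compose[OF continuous_map_snd continuous_map_column] by (simp add: o_def)
  consider "n = 0" | "n = 1" "A = {}" | "n = 1" "A \<noteq> {}" | k where "n = Suc k" "k \<ge> 1"
    by (cases n) force+
  then show ?thesis
  proof cases
    case 1
    then show ?thesis using A by (simp add: Sigma1_def)
  next
    case 2
    then show ?thesis by (simp only: Sigma1_1) (simp add: analytic_in_def)
  next
    case 3
    then obtain f where f: "continuous_map baire_space Z f" "range f = A"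
      using A Sigma1_1 analytic_in_iff_baire_image by metis
    have "continuous_map ?YN Z (\<lambda>x. f (column m (snd x)))" for m
      using continuous_map_compose[OF col f(1)] by (simp add: o_def)
    then have "closedin ?YN (\<Inter>m. {x \<in> topspace ?YN. h m (fst x) = f (column m (snd x))})"
      by (intro closedin_INT closedin_continuous_maps_eq[OF Z h_fst]) auto
    from analytic_in_Int_closedin[OF YN(1) this]
    have "analytic_in Y (fst ` (topspace ?YN \<inter>
        (\<Inter>m. {x \<in> topspace ?YN. h m (fst x) = f (column m (snd x))})))"
      by (rule analytic_in_continuous_image) (rule continuous_map_fst)
    also have "fst ` (topspace ?YN \<inter>
        (\<Inter>m. {x \<in> topspace ?YN. h m (fst x) = f (column m (snd x))})) =
        {y \<in> topspace Y. \<forall>m. h m y \<in> A}"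
    proof (intro subset_antisym subsetI)
      fix y assume y: "y \<in> {y \<in> topspace Y. \<forall>m. h m y \<in> A}"
      then have "\<forall>m. \<exists>z. h m y = f z" using f(2) by auto
      then obtain z where "\<And>m. h m y = f (z m)" by metis
      then show "y \<in> fst ` (topspace ?YN \<inter>
          (\<Inter>m. {x \<in> topspace ?YN. h m (fst x) = f (column m (snd x))}))"
        using y by (intro image_eqI[of _ _ "(y, interleave z)"]) auto
    qed (use f(2) in auto)
    finally show ?thesis unfolding 3(1) Sigma1_1 .
  next
    case 4
    obtain B where B: "Pi1 k ?ZN B" "A = fst ` B"
      using A unfolding 4 Sigma1_Suc[OF 4(2)] by blast
    define G where "G m x = (h m (fst x), column m (snd x))" for m and x :: "'a \<times> (nat \<Rightarrow> nat)"
    have G: "continuous_map ?YN ?ZN (G m)" for m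
      unfolding G_def by (intro continuous_map_pairedI h_fst col)
    let ?B = "{x \<in> topspace ?YN. \<forall>m. G m x \<in> B}"
    have "continuous_map (prod_topology ?YN baire_space) (discrete_topology UNIV) (\<lambda>y. snd y 0)"
      using continuous_map_compose[OF continuous_map_snd continuous_map_digit] by (simp add: o_def)
    moreover have "continuous_map (prod_topology ?YN baire_space) ?ZN (\<lambda>y. G m (fst y))" for m
      using continuous_map_compose[OF continuous_map_fst G] by (simp add: o_def)
    ultimately have "continuous_map (prod_topology ?YN baire_space) ?ZN (\<lambda>y. G (snd y 0) (fst y))"
      by (rule continuous_map_discrete_case)
    moreover have "Sigma1 k ?ZN (topspace ?ZN - B)"
      using B(1) by (simp add: Pi1_def)
    moreover have "Hausdorff_space ?ZN"
      using Z by (simp add: Hausdorff_space_prod_topology Hausdorff_space_product_topology)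
    ultimately have "Sigma1 k (prod_topology ?YN baire_space)
        {y \<in> topspace (prod_topology ?YN baire_space). G (snd y 0) (fst y) \<in> topspace ?ZN - B}"
      by (intro Sigma1_vimage[OF analytic_in_topspace_prod_baire[OF YN(1)]])
    from Sigma1_projection[OF YN this]
    have "Sigma1 k ?YN
        (fst ` {y \<in> topspace (prod_topology ?YN baire_space). G (snd y 0) (fst y) \<in> topspace ?ZN - B})" .
    also have "fst ` {y \<in> topspace (prod_topology ?YN baire_space).
        G (snd y 0) (fst y) \<in> topspace ?ZN - B} = topspace ?YN - ?B"
    proof (intro subset_antisym subsetI)
      fix x assume "x \<in> topspace ?YN - ?B"
      then obtain m where x: "x \<in> topspace ?YN" "G m x \<notin> B" by blast
      moreover have "G m x \<in> topspace ?ZN"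
        using continuous_map_image_subset_topspace[OF G] x(1) by blast
      ultimately show "x \<in> fst ` {y \<in> topspace (prod_topology ?YN baire_space).
          G (snd y 0) (fst y) \<in> topspace ?ZN - B}"
        by (intro image_eqI[of _ _ "(x, \<lambda>_. m)"]) auto
    next
      fix x assume "x \<in> fst ` {y \<in> topspace (prod_topology ?YN baire_space).
          G (snd y 0) (fst y) \<in> topspace ?ZN - B}"
      then obtain y where "y \<in> topspace (prod_topology ?YN baire_space)"
          "G (snd y 0) (fst y) \<notin> B" "x = fst y" by blast
      then have "x \<in> topspace ?YN" "G (snd y 0) x \<notin> B" by auto
      then show "x \<in> topspace ?YN - ?B" by blast
    qed
    finally have "Pi1 k ?YN ?B" by (auto simp: Pi1_def)
    moreover have "{y \<in> topspace Y. \<forall>m. h m y \<in> A} = fst ` ?B"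
    proof (intro subset_antisym subsetI)
      fix y assume y: "y \<in> {y \<in> topspace Y. \<forall>m. h m y \<in> A}"
      then have "\<forall>m. \<exists>z. (h m y, z) \<in> B" using B(2) by fastforce
      then obtain z where "\<And>m. (h m y, z m) \<in> B" by metis
      then show "y \<in> fst ` ?B"
        using y by (intro image_eqI[of _ _ "(y, interleave z)"]) (auto simp: G_def)
    qed (use B(2) in \<open>force simp: G_def\<close>)
    ultimately show ?thesis
      unfolding 4(1) Sigma1_Suc[OF 4(2)] by blast
  qed
qed

section \<open>The Baire property\<close>

lemma nowhere_dense_in_homeomorphic_image:
  assumes h: "homeomorphic_map X Y h" and S: "nowhere_dense_in X S"
  shows "nowhere_dense_in Y (h ` S)"
proof -
  have S': "S \<subseteq> topspace X" "X interior_of (X closure_of S) = {}"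
    using S by (auto simp: nowhere_dense_in_def)
  have "Y interior_of (Y closure_of (h ` S)) = h ` (X interior_of (X closure_of S))"
    using homeomorphic_map_closure_of[OF h S'(1)]
      homeomorphic_map_interior_of[OF h closure_of_subset_topspace] by simp
  then show ?thesis
    using S' homeomorphic_imp_surjective_map[OF h] unfolding nowhere_dense_in_def by blast
qed

lemma meagre_in_homeomorphic_image:
  assumes h: "homeomorphic_map X Y h" and S: "meagre_in X S"
  shows "meagre_in Y (h ` S)"
proof -
  obtain D where "countable D" "\<forall>T\<in>D. nowhere_dense_in X T" "S = \<Union>D"
    using S by (auto simp: meagre_in_def)
  then show ?thesis
    unfolding meagre_in_def using nowhere_dense_in_homeomorphic_image[OF h]
    by (intro exI[of _ "(`) h ` D"]) auto
qed

lemma Baire_measurable_homeomorphic_image: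
  assumes h: "homeomorphic_map X Y h" and A: "Baire_measurable X A"
  shows "Baire_measurable Y (h ` A)"
proof -
  obtain U where U: "A \<subseteq> topspace X" "openin X U" "meagre_in X ((A - U) \<union> (U - A))"
    using A by (auto simp: Baire_measurable_def)
  note U' = openin_subset[OF U(2)]
  have inj: "inj_on h (topspace X)"
    by (rule homeomorphic_imp_injective_map[OF h])
  have "h ` ((A - U) \<union> (U - A)) = (h ` A - h ` U) \<union> (h ` U - h ` A)"
    using inj_on_image_set_diff[OF inj, of A U] inj_on_image_set_diff[OF inj, of U A] U(1) U'
    by (simp add: image_Un Diff_subset[THEN subset_trans])
  then have "meagre_in Y ((h ` A - h ` U) \<union> (h ` U - h ` A))"
    using meagre_in_homeomorphic_image[OF h U(3)] by simp
  moreover have "openin Y (h ` U)"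
    using homeomorphic_map_openness[OF h U'] U(2) by simp
  moreover have "h ` A \<subseteq> topspace Y"
    using U(1) homeomorphic_imp_surjective_map[OF h] by auto
  ultimately show ?thesis by (auto simp: Baire_measurable_def)
qed

lemma Polish_imp_analytic_in:
  assumes "Polish X"
  shows "analytic_in X (topspace X)"
proof (cases "topspace X = {}")
  case False
  then show ?thesis
    using Polish_imp_baire_image[OF assms False] by (metis analytic_in_iff_baire_image)
qed (simp add: analytic_in_def)

text \<open>A right inverse of a surjection from the Baire space embeds the points of \<open>X\<close> into \<^typ>\<open>nat \<Rightarrow> nat\<close>;
  the topology is pulled back from \<open>X\<close>, not induced from the Baire space.\<close>

lemma Polish_homeomorphic_baire_subset:
  assumes X: "Polish X" "topspace X \<noteq> {}"
  obtains T :: "(nat \<Rightarrow> nat) topology" and h where "Polish T" "homeomorphic_map T X h"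
proof -
  obtain f where f: "continuous_map baire_space X f" "range f = topspace X"
    using Polish_imp_baire_image[OF X] by blast
  define S where "S = inv f ` topspace X"
  define T where "T = pullback_topology S f X"
  have f_inv: "f (inv f x) = x" if "x \<in> topspace X" for x
    using that f(2) by (metis f_inv_into_f)
  have f_S: "f ` S = topspace X"
    using f_inv by (force simp: S_def)
  have T: "topspace T = S"
    using f_S by (auto simp: T_def topspace_pullback_topology)
  have "homeomorphic_map T X f"
  proof (rule bijective_open_imp_homeomorphic_map)
    show "continuous_map T X f"
      using continuous_map_pullback[of X X id S f] by (simp add: T_def)
    show "open_map T X f"
      unfolding open_map_def
    proof (intro allI impI)
      fix V assume "openin T V"
      then obtain U where U: "openin X U" "V = f -` U \<inter> S"
        by (auto simp: T_def openin_pullback_topology)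
      then have "f ` V = U"
        using f_S openin_subset[OF U(1)] by fast
      then show "openin X (f ` V)" using U(1) by simp
    qed
    show "f ` topspace T = topspace X" using T f_S by simp
    show "inj_on f (topspace T)"
      using f_inv by (auto simp: T S_def intro!: inj_onI)
  qed
  moreover from this have "T homeomorphic_space X"
    by (rule homeomorphic_map_imp_homeomorphic_space)
  then have "Polish T"
    using X(1) homeomorphic_completely_metrizable_space homeomorphic_separable_space
    by (auto simp: Polish_def)
  ultimately show thesis using that by blast
qed

lemma Baire_measurable_if_Delta1:
  assumes BM: "\<forall>(T :: (nat \<Rightarrow> nat) topology) A. Polish T \<longrightarrow> Delta1 n T A \<longrightarrow> Baire_measurable T A"
    and X: "Polish X" "topspace X \<noteq> {}" and A: "Delta1 n X A"
  shows "Baire_measurable X A"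
proof -
  obtain T :: "(nat \<Rightarrow> nat) topology" and h where T: "Polish T" and h: "homeomorphic_map T X h"
    using Polish_homeomorphic_baire_subset[OF X] by blast
  have "Hausdorff_space X"
    using X(1) by (simp add: Polish_def completely_metrizable_imp_metrizable_space
        metrizable_imp_Hausdorff_space)
  note vimage = Sigma1_vimage[OF Polish_imp_analytic_in[OF T] this homeomorphic_imp_continuous_map[OF h]]
    Pi1_vimage[OF Polish_imp_analytic_in[OF T] this homeomorphic_imp_continuous_map[OF h]]
  have "Delta1 n T {t \<in> topspace T. h t \<in> A}"
    using A vimage by (simp add: Delta1_def)
  then have "Baire_measurable T {t \<in> topspace T. h t \<in> A}"
    using BM T by blast
  from Baire_measurable_homeomorphic_image[OF h this]
  have "Baire_measurable X (h ` {t \<in> topspace T. h t \<in> A})" .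
  moreover have "A \<subseteq> h ` topspace T"
    using A homeomorphic_imp_surjective_map[OF h] by (simp add: Delta1_def Pi1_def)
  then have "h ` {t \<in> topspace T. h t \<in> A} = A" by auto
  ultimately show ?thesis by simp
qed

text \<open>The Baire category theorem in the form in which it is used.\<close>

lemma meagre_in_interior_empty:
  assumes X: "completely_metrizable_space X" and S: "meagre_in X S"
  shows "X interior_of S = {}"
proof -
  obtain D where D: "countable D" "\<forall>T\<in>D. nowhere_dense_in X T" "S = \<Union>D"
    using S by (auto simp: meagre_in_def)
  have "X interior_of \<Union>((closure_of) X ` D) = {}"
    using X D by (intro Baire_category_alt) (auto simp: nowhere_dense_in_def)
  moreover have "S \<subseteq> \<Union>((closure_of) X ` D)"
    using D(2,3) closure_of_subset unfolding nowhere_dense_in_def by fastforce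
  ultimately show ?thesis
    using interior_of_mono by blast
qed

lemma meagre_in_subset:
  assumes "meagre_in X S" "R \<subseteq> S"
  shows "meagre_in X R"
proof -
  obtain D where D: "countable D" "\<forall>T\<in>D. nowhere_dense_in X T" "S = \<Union>D"
    using assms by (auto simp: meagre_in_def)
  have "nowhere_dense_in X (T \<inter> R)" if "T \<in> D" for T
    using D(2) that closure_of_mono[of "T \<inter> R" T X] interior_of_mono
    unfolding nowhere_dense_in_def by blast
  then show ?thesis
    unfolding meagre_in_def using D assms(2)
    by (intro exI[of _ "(\<lambda>T. T \<inter> R) ` D"]) auto
qed

lemma meagre_in_UN:
  assumes "countable I" "\<And>i. i \<in> I \<Longrightarrow> meagre_in X (S i)"
  shows "meagre_in X (\<Union>i\<in>I. S i)"
proof -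
  have "\<forall>i\<in>I. \<exists>D. countable D \<and> (\<forall>T\<in>D. nowhere_dense_in X T) \<and> S i = \<Union>D"
    using assms(2) by (simp add: meagre_in_def)
  then obtain D where "\<forall>i\<in>I. countable (D i) \<and> (\<forall>T\<in>D i. nowhere_dense_in X T) \<and> S i = \<Union>(D i)"
    by metis
  then show ?thesis
    unfolding meagre_in_def using assms(1)
    by (intro exI[of _ "\<Union>i\<in>I. D i"]) auto
qed

text \<open>The sublevel sets cover the space, so one of them agrees up to a meagre set with a nonempty open
  set, hence is comeagre in a ball. For small \<open>h\<close> its translate by \<open>h\<close> is comeagre in a smaller concentric
  ball, so the two meet, and \<open>h\<close> is a difference of two elements of the sublevel set. This bounds \<open>f\<close> near
  \<open>0\<close>.\<close>

lemma continuous_if_Baire_measurable: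
  fixes f :: "'a::banach \<Rightarrow> 'b::real_normed_vector"
  assumes lin: "linear f" and BM: "\<And>N :: nat. Baire_measurable euclidean {x. norm (f x) \<le> real N}"
  shows "continuous_on UNIV f"
proof -
  interpret linear f by fact
  let ?X = "euclidean :: 'a topology" and ?E = "\<lambda>N :: nat. {x. norm (f x) \<le> real N}"
  have meagre_interior: "interior S = {}" if "meagre_in ?X S" for S
    using meagre_in_interior_empty[OF completely_metrizable_space_euclidean that] by simp
  obtain U where U: "\<And>N. open (U N)" "\<And>N. meagre_in ?X ((?E N - U N) \<union> (U N - ?E N))"
    using BM unfolding Baire_measurable_def by (metis open_openin)
  have "\<exists>N. U N \<noteq> {}"
  proof (rule ccontr)
    assume "\<nexists>N. U N \<noteq> {}"
    then have "meagre_in ?X (?E N)" for N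
      using U(2)[of N] by simp
    then have "meagre_in ?X (\<Union>N. ?E N)"
      by (intro meagre_in_UN) auto
    moreover have "(\<Union>N. ?E N) = UNIV"
      using real_arch_simple by auto
    ultimately show False using meagre_interior by fastforce
  qed
  then obtain N u where "u \<in> U N" by blast
  then obtain r where r: "r > 0" "ball u (2 * r) \<subseteq> U N"
    using U(1)[of N] open_contains_ball by (metis field_sum_of_halves half_gt_zero mult_2 )
  have M: "meagre_in ?X (U N - ?E N)"
    using U(2) by (rule meagre_in_subset) blast
  have bound: "norm (f h) \<le> 2 * real N" if h: "norm h < r" for h
  proof -
    have "homeomorphic_map ?X ?X ((+) h)"
    proof (rule homeomorphic_maps_imp_map)
      show "homeomorphic_maps ?X ?X ((+) h) ((+) (- h))"
        by (simp add: homeomorphic_maps_def continuous_intros)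
    qed
    then have "meagre_in ?X ((+) h ` (U N - ?E N))"
      using M by (rule meagre_in_homeomorphic_image)
    then have "meagre_in ?X (\<Union>i::bool. if i then U N - ?E N else (+) h ` (U N - ?E N))"
      using M by (intro meagre_in_UN) auto
    then have "meagre_in ?X ((U N - ?E N) \<union> (+) h ` (U N - ?E N))"
      by (simp add: UNIV_bool Un_commute)
    moreover have "interior (ball u r) \<noteq> {}"
      using r by simp
    ultimately have "\<not> ball u r \<subseteq> (U N - ?E N) \<union> (+) h ` (U N - ?E N)"
      using meagre_interior interior_mono by blast
    then obtain x where x: "x \<in> ball u r" "x \<notin> U N - ?E N" "x \<notin> (+) h ` (U N - ?E N)"
      by blast
    have "norm (u - (x - h)) \<le> norm (u - x) + norm h"
      using norm_triangle_ineq[of "u - x" h] by (simp add: algebra_simps)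
    then have "x \<in> U N" "x - h \<in> U N"
      using x(1) r h by (auto simp: dist_norm intro!: subsetD[OF r(2)])
    then have "x \<in> ?E N"
      using x(2) by blast
    moreover have "x = h + (x - h)" by simp
    then have "x - h \<notin> U N - ?E N"
      using x(3) by blast
    then have "x - h \<in> ?E N"
      using \<open>x - h \<in> U N\<close> by blast
    moreover have "f h = f x - f (x - h)"
      by (simp add: diff)
    ultimately show ?thesis
      using norm_triangle_ineq4[of "f x" "f (x - h)"] by simp
  qed
  have "norm (f x) \<le> norm x * (4 * real N / r)" for x
  proof (cases "x = 0")
    case False
    define c where "c = r / (2 * norm x)"
    have c: "c > 0" using r False by (simp add: c_def)
    have "norm (c *\<^sub>R x) < r" using r False by (simp add: c_def)
    then have "c * norm (f x) \<le> 2 * real N"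
      using bound[of "c *\<^sub>R x"] c by (simp add: scale)
    then show ?thesis
      using r False by (simp add: c_def field_simps)
  qed (simp add: zero)
  then have "bounded_linear f"
    by (intro bounded_linear_intro[of f "4 * real N / r"]) (auto simp: add scale)
  then show ?thesis
    by (simp add: linear_continuous_on)
qed

section \<open>Coordinate functionals\<close>

lemma filter_expansion_coord:
  assumes "filter_basis F mul e"
  shows "filter_expansion F mul e x (\<lambda>k. coord_functional F mul e k x)"
  using theI'[of "filter_expansion F mul e x"] assms
  unfolding filter_basis_def coord_functional_def by auto

lemma coord_eqI:
  assumes "filter_basis F mul e" "filter_expansion F mul e x a"
  shows "coord_functional F mul e k x = a k"
  using the1_equality[of "filter_expansion F mul e x" a] assms
  unfolding filter_basis_def coord_functional_def by auto

lemma linear_coord_functional: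
  assumes mul: "bounded_bilinear mul" and e: "filter_basis F mul e"
  shows "linear (coord_functional F mul e k)"
proof
  interpret bounded_bilinear mul by fact
  note exp = filter_expansion_coord[OF e, unfolded filter_expansion_def]
  show "coord_functional F mul e k (x + y) = coord_functional F mul e k x + coord_functional F mul e k y" for x y
    using tendsto_add[OF exp[of x] exp[of y]]
    by (intro coord_eqI[OF e]) (simp add: filter_expansion_def sum.distrib[symmetric] add_left)
  show "coord_functional F mul e k (c *\<^sub>R x) = c *\<^sub>R coord_functional F mul e k x" for c x
    using tendsto_scaleR[OF tendsto_const exp[of x], of c]
    by (intro coord_eqI[OF e]) (simp add: filter_expansion_def scaleR_sum_right scaleR_left)
qed

text \<open>Along the improper filter every sequence converges to every point, so expansions are not unique.\<close>

lemma filter_basis_nontrivial: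
  fixes mul :: "'k::real_normed_field \<Rightarrow> 'a::real_normed_vector \<Rightarrow> 'a"
  assumes "filter_basis F mul e"
  shows "F \<noteq> bot"
proof
  assume "F = bot"
  then have "filter_expansion F mul e 0 (\<lambda>_. 0)" "filter_expansion F mul e 0 (\<lambda>_. 1)"
    by (auto simp: filter_expansion_def)
  then have "(\<lambda>_. 0 :: 'k) = (\<lambda>_ :: nat. 1)"
    using assms by (auto simp: filter_basis_def)
  then show False by (auto simp: fun_eq_iff)
qed

lemma Polish_euclidean:
  "Polish (euclidean :: 'a::{complete_space, second_countable_topology} topology)"
proof -
  obtain D :: "'a set" where D: "countable D" "\<And>X. open X \<Longrightarrow> X \<noteq> {} \<Longrightarrow> \<exists>d\<in>D. d \<in> X"
    using countable_dense_exists by metis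
  have "closure D = UNIV"
    using D(2) closure_approachable[of _ D] by (metis UNIV_eq_I centre_in_ball dist_commute empty_iff mem_ball open_ball)
  then have "separable_space (euclidean :: 'a topology)"
    unfolding separable_space_def using D(1) by auto
  then show ?thesis
    by (simp add: Polish_def completely_metrizable_space_euclidean)
qed

text \<open>A limit along a proper filter lies in the closure of the partial sums. For each length these form a
  continuous image of the Baire space, and images of a countable dense set of codes are dense in them.\<close>

lemma filter_basis_Polish:
  fixes mul :: "'k::{real_normed_field, banach, second_countable_topology} \<Rightarrow> 'a::banach \<Rightarrow> 'a"
  assumes mul: "bounded_bilinear mul" and e: "filter_basis F mul e"
  shows "Polish (euclidean :: 'a topology)"
proof -
  interpret bounded_bilinear mul by fact
  obtain \<rho> :: "(nat \<Rightarrow> nat) \<Rightarrow> 'k" where \<rho>: "continuous_map baire_space euclidean \<rho>" "range \<rho> = UNIV"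
    using Polish_imp_baire_image[OF Polish_euclidean] by (metis UNIV_not_empty topspace_euclidean)
  have \<rho>_col: "continuous_on UNIV (\<lambda>z. \<rho> (column i z))" for i
    using continuous_map_compose[OF continuous_map_column \<rho>(1)]
    by (simp add: o_def baire_space_euclidean)
  define g where "g m z = (\<Sum>i\<le>m. mul (\<rho> (column i z)) (e i))" for m z
  have g: "continuous_on UNIV (g m)" for m
    unfolding g_def by (intro continuous_intros continuous_on \<rho>_col)
  obtain D :: "(nat \<Rightarrow> nat) set" where D: "countable D" "closure D = UNIV"
    using Polish_baire_space unfolding Polish_def separable_space_def baire_space_euclidean by auto
  let ?T = "\<Union>m. g m ` D"
  have "x \<in> closure ?T" for x
  proof -
    let ?a = "\<lambda>i. coord_functional F mul e i x"
    have "\<forall>i. \<exists>u. ?a i = \<rho> u" using \<rho>(2) by (metis rangeE UNIV_I)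
    then obtain u where u: "\<And>i. ?a i = \<rho> (u i)" by metis
    have "g m ` closure D \<subseteq> closure ?T" for m
      using g[of m] D(2) closure_subset[of ?T] by (intro image_closure_subset) auto
    then have "g m (interleave u) \<in> closure ?T" for m
      using D(2) by blast
    then have "(\<Sum>i\<le>m. mul (?a i) (e i)) \<in> closure ?T" for m
      by (simp add: g_def u)
    then show ?thesis
      using filter_expansion_coord[OF e, of x] filter_basis_nontrivial[OF e]
      unfolding filter_expansion_def by (intro Lim_in_closed_set[OF closed_closure]) auto
  qed
  then have "closure ?T = UNIV" by blast
  moreover have "countable ?T" using D(1) by auto
  ultimately have "separable_space (euclidean :: 'a topology)"
    unfolding separable_space_def by (intro exI[of _ ?T]) auto
  then show ?thesis
    by (simp add: Polish_def completely_metrizable_space_euclidean)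
qed

text \<open>The index \<open>j\<close> serves to treat a countable union of closed conditions, such as an open one, on
  the same footing as a closed condition. It becomes a part of the code \<open>z\<close>: column 0 of \<open>z\<close> starts with \<open>j\<close>,
  column 1 codes the sets \<open>A\<^sub>m\<close> of the filter by the zeros of its columns, and the remaining columns
  are codes for the coefficients.\<close>

lemma Sigma1_coord_functional:
  fixes mul :: "'k::{real_normed_field, banach, second_countable_topology} \<Rightarrow> 'a::banach \<Rightarrow> 'a"
    and Q :: "nat \<Rightarrow> 'k \<Rightarrow> bool"
  assumes mul: "bounded_bilinear mul" and e: "filter_basis F mul e"
    and F: "Sigma1 n cantor_space {P. eventually P F}"
    and Q: "\<And>j. closed {c. Q j c}"
  shows "Sigma1 n euclidean {x. \<exists>j. Q j (coord_functional F mul e k x)}"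
proof -
  interpret bounded_bilinear mul by fact
  have X: "analytic_in (euclidean :: 'a topology) (topspace euclidean)"
    using filter_basis_Polish[OF mul e] by (rule Polish_imp_analytic_in)
  let ?Y = "prod_topology (euclidean :: 'a topology) baire_space"
  have Y_eq: "?Y = euclidean"
    by (simp add: baire_space_euclidean)
  have Y: "analytic_in ?Y (topspace ?Y)" "Hausdorff_space ?Y"
    using analytic_in_topspace_prod_baire[OF X]
    by (simp_all add: Hausdorff_space_prod_topology Hausdorff_space_product_topology
        del: topspace_prod_topology)
  obtain \<rho> :: "(nat \<Rightarrow> nat) \<Rightarrow> 'k" where \<rho>: "continuous_map baire_space euclidean \<rho>" "range \<rho> = UNIV"
    using Polish_imp_baire_image[OF Polish_euclidean] by (metis UNIV_not_empty topspace_euclidean)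
  define a where "a z i = \<rho> (column (i + 2) z)" for z i
  define p where "p m x = (\<lambda>l. column m (column 1 (snd x)) l = 0)" for m and x :: "'a \<times> (nat \<Rightarrow> nat)"
  have digit: "continuous_map ?Y (discrete_topology UNIV) (\<lambda>x. snd x i)" for i
    using continuous_map_compose[OF continuous_map_snd continuous_map_digit] by (simp add: o_def)
  have open_digit: "open {x :: 'a \<times> (nat \<Rightarrow> nat). snd x i = j}" for i j
    using openin_continuous_map_preimage[OF digit, of "{j}"] by (simp add: Y_eq)
  have p: "continuous_map ?Y cantor_space (p m)" for m
  proof -
    have "continuous_map ?Y (discrete_topology UNIV) (\<lambda>x. p m x l)" for l
      unfolding p_def column_def
      using continuous_map_compose[OF digit, of "discrete_topology UNIV" "\<lambda>v. v = 0"]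
      by (simp add: o_def)
    then show ?thesis by (simp add: continuous_map_componentwise_UNIV)
  qed
  have open_p: "open {x. p m x l}" for m l
    unfolding p_def column_def by (rule open_digit)
  have a: "continuous_on UNIV (\<lambda>x :: 'a \<times> (nat \<Rightarrow> nat). a (snd x) i)" for i
    using continuous_map_compose[OF continuous_map_compose[OF continuous_map_snd continuous_map_column] \<rho>(1),
        of "euclidean :: 'a topology" "i + 2"]
    by (simp add: o_def a_def baire_space_euclidean)
  let ?C = "{x :: 'a \<times> (nat \<Rightarrow> nat). (\<forall>j. snd x 0 = j \<longrightarrow> Q j (a (snd x) k)) \<and>
      (\<forall>m l. p m x l \<longrightarrow> norm ((\<Sum>i\<le>l. mul (a (snd x) i) (e i)) - fst x) \<le> inverse (real (Suc m)))}"
  have "closed {x :: 'a \<times> (nat \<Rightarrow> nat). Q j (a (snd x) k)}" for j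
    using closed_vimage[OF Q[of j] a[of k]] by (simp add: vimage_def)
  then have "closed ?C"
    by (intro closed_Collect_conj closed_Collect_all closed_Collect_imp open_digit open_p
        closed_Collect_le continuous_intros continuous_on a)
  then have "closedin ?Y ?C" by (simp add: Y_eq)
  moreover have "Hausdorff_space cantor_space"
    by (simp add: Hausdorff_space_product_topology)
  ultimately have "Sigma1 n ?Y ({x \<in> topspace ?Y. \<forall>m. p m x \<in> {P. eventually P F}} \<inter> ?C)"
    using Sigma1_INT_vimage[OF Y _ p F] by (intro Sigma1_Int_closedin[OF Y(1)])
  then have "Sigma1 n euclidean (fst ` ({x \<in> topspace ?Y. \<forall>m. p m x \<in> {P. eventually P F}} \<inter> ?C))"
    by (intro Sigma1_projection[OF X]) auto
  also have "fst ` ({x \<in> topspace ?Y. \<forall>m. p m x \<in> {P. eventually P F}} \<inter> ?C) =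
      {x. \<exists>j. Q j (coord_functional F mul e k x)}"
  proof (intro subset_antisym subsetI)
    fix x assume "x \<in> fst ` ({x \<in> topspace ?Y. \<forall>m. p m x \<in> {P. eventually P F}} \<inter> ?C)"
    then obtain y where xy: "x = fst y"
        and y': "y \<in> {x \<in> topspace ?Y. \<forall>m. p m x \<in> {P. eventually P F}} \<inter> ?C"
      by (rule imageE)
    have y: "y \<in> ?C" "\<forall>m. eventually (p m y) F"
      using IntD2[OF y'] IntD1[OF y'] by simp_all
    obtain z where z: "y = (x, z)"
      using xy by (cases y) simp
    have ev: "\<forall>\<^sub>F l in F. p m (x, z) l" for m
      using y(2) z by simp
    have Qz: "Q (z 0) (a z k)"
      using y(1) unfolding z mem_Collect_eq snd_conv by blast
    have near: "norm ((\<Sum>i\<le>l. mul (a z i) (e i)) - x) \<le> inverse (real (Suc m))" if "p m (x, z) l" for m l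
      using y(1) that unfolding z mem_Collect_eq snd_conv fst_conv by blast
    \<comment> \<open>A point coded by \<open>z\<close> has the expansion coded by \<open>z\<close>, which is its only one.\<close>
    have "filter_expansion F mul e x (a z)"
      unfolding filter_expansion_def
    proof (rule tendstoI)
      fix \<epsilon> :: real assume "\<epsilon> > 0"
      then obtain m where m: "inverse (real (Suc m)) < \<epsilon>"
        using reals_Archimedean by blast
      show "\<forall>\<^sub>F l in F. dist (\<Sum>i\<le>l. mul (a z i) (e i)) x < \<epsilon>"
        using ev[of m] by (rule eventually_mono)
          (use near m in \<open>force simp: dist_norm simp del: of_nat_Suc intro: le_less_trans\<close>)
    qed
    then show "x \<in> {x. \<exists>j. Q j (coord_functional F mul e k x)}"
      using coord_eqI[OF e] Qz by auto
  next
    fix x assume "x \<in> {x. \<exists>j. Q j (coord_functional F mul e k x)}"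
    then obtain j where j: "Q j (coord_functional F mul e k x)" by blast
    let ?a = "\<lambda>i. coord_functional F mul e i x"
    have "\<forall>i. \<exists>u. ?a i = \<rho> u" using \<rho>(2) by (metis rangeE UNIV_I)
    then obtain u where u: "\<And>i. ?a i = \<rho> (u i)" by metis
    \<comment> \<open>The largest possible sets \<open>A\<^sub>m\<close>.\<close>
    define w where "w m l = (if norm ((\<Sum>i\<le>l. mul (?a i) (e i)) - x) \<le> inverse (real (Suc m)) then 0 else 1 :: nat)"
      for m l
    define z where "z = interleave (case_nat (\<lambda>_. j) (case_nat (interleave w) u))"
    have z: "column 0 z = (\<lambda>_. j)" "column 1 z = interleave w" "column (i + 2) z = u i" for i
      by (auto simp: z_def)
    have a_z: "a z = ?a"
      by (simp add: a_def z u fun_eq_iff del: add_2_eq_Suc')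
    have p_z: "p m (x, z) = (\<lambda>l. norm ((\<Sum>i\<le>l. mul (?a i) (e i)) - x) \<le> inverse (real (Suc m)))" for m
      unfolding p_def snd_conv z(2) column_interleave by (simp add: w_def del: of_nat_Suc)
    have "eventually (p m (x, z)) F" for m
    proof -
      have "\<forall>\<^sub>F l in F. dist (\<Sum>i\<le>l. mul (?a i) (e i)) x < inverse (real (Suc m))"
        using filter_expansion_coord[OF e, of x] unfolding filter_expansion_def
        by (rule tendstoD) simp
      then show ?thesis unfolding p_z
        by (rule eventually_mono) (simp add: dist_norm)
    qed
    \<comment> \<open>\<open>snd x 0\<close> reads the first entry of column 0, since the pair \<open>(0, 0)\<close> has code \<open>0\<close>.\<close>
    moreover have "z 0 = j"
      using fun_cong[OF z(1), of 0] by (simp add: column_def prod_encode_def)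
    ultimately show "x \<in> fst ` ({x \<in> topspace ?Y. \<forall>m. p m x \<in> {P. eventually P F}} \<inter> ?C)"
      using j by (intro image_eqI[of _ _ "(x, z)"]) (auto simp: a_z p_z)
  qed
  finally show ?thesis .
qed

lemma continuous_coord_functional:
  fixes mul :: "'k::{real_normed_field, banach, second_countable_topology} \<Rightarrow> 'a::banach \<Rightarrow> 'a"
  assumes BM: "\<forall>(T :: (nat \<Rightarrow> nat) topology) A. Polish T \<longrightarrow> Delta1 n T A \<longrightarrow> Baire_measurable T A"
    and F: "Sigma1 n cantor_space {P. eventually P F}"
    and mul: "bounded_bilinear mul" and e: "filter_basis F mul e"
  shows "continuous_on UNIV (coord_functional F mul e k)"
proof (rule continuous_if_Baire_measurable[OF linear_coord_functional[OF mul e]])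
  fix N :: nat
  let ?f = "coord_functional F mul e k"
  have closed: "closed {c :: 'k. norm c \<le> real N}"
      "closed {c :: 'k. norm c \<ge> real N + inverse (real (Suc j))}" for j
    by (intro closed_Collect_le continuous_intros)+
  have "Sigma1 n euclidean {x. norm (?f x) \<le> real N}"
    using Sigma1_coord_functional[OF mul e F, of "\<lambda>_ c. norm c \<le> real N" k] closed(1) by simp
  moreover have "{x. \<exists>j. norm (?f x) \<ge> real N + inverse (real (Suc j))} = UNIV - {x. norm (?f x) \<le> real N}"
  proof (intro subset_antisym subsetI)
    fix x assume "x \<in> UNIV - {x. norm (?f x) \<le> real N}"
    then have "norm (?f x) - real N > 0" by auto
    then obtain j where "inverse (real (Suc j)) < norm (?f x) - real N"
      using reals_Archimedean by blast
    then show "x \<in> {x. \<exists>j. norm (?f x) \<ge> real N + inverse (real (Suc j))}"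
      by (auto intro!: exI[of _ j])
  next
    fix x assume "x \<in> {x. \<exists>j. norm (?f x) \<ge> real N + inverse (real (Suc j))}"
    then obtain j where "norm (?f x) \<ge> real N + inverse (real (Suc j))" by blast
    moreover have "inverse (real (Suc j)) > 0" by simp
    ultimately have "norm (?f x) > real N" by linarith
    then show "x \<in> UNIV - {x. norm (?f x) \<le> real N}" by simp
  qed
  then have "Sigma1 n euclidean (UNIV - {x. norm (?f x) \<le> real N})"
    using Sigma1_coord_functional[OF mul e F, of "\<lambda>j c. norm c \<ge> real N + inverse (real (Suc j))" k]
      closed(2) by (simp del: of_nat_Suc)
  ultimately have "Delta1 n euclidean {x. norm (?f x) \<le> real N}"
    by (simp add: Delta1_def Pi1_def)
  then show "Baire_measurable euclidean {x. norm (?f x) \<le> real N}"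
    by (intro Baire_measurable_if_Delta1[OF BM filter_basis_Polish[OF mul e]]) auto
qed

lemma (in complex_banach) bounded_bilinear_mul: "bounded_bilinear mul"
proof
  show "mul (r *\<^sub>R a) b = r *\<^sub>R mul a b" for r a b
    by (simp add: scaleR_conv_of_real mul_of_real flip: scale_scale)
  show "mul a (r *\<^sub>R b) = r *\<^sub>R mul a b" for r a b
    by (simp add: mult.commute flip: mul_of_real)
  show "\<exists>K. \<forall>a b. norm (mul a b) \<le> norm a * norm b * K"
    by (intro exI[of _ 1]) (simp add: norm_mul)
qed (auto simp: scale_left_distrib scale_right_distrib)

theorem mainTheorem3:
  fixes n :: nat and F :: "nat filter"
  assumes "n \<ge> 1"
    and "\<forall>(X :: (nat \<Rightarrow> nat) topology) A. Polish X \<longrightarrow> Delta1 n X A \<longrightarrow> Baire_measurable X A"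
    and "F \<le> cofinite"
    and "Sigma1 n cantor_space {P. eventually P F}"
  shows "(\<forall>(e :: nat \<Rightarrow> 'a::banach) k. filter_basis F scaleR e \<longrightarrow>
            continuous_on UNIV (coord_functional F scaleR e k)) \<and>
         (\<forall>(mul :: complex \<Rightarrow> 'b::banach \<Rightarrow> 'b) e k.
            complex_banach mul \<longrightarrow> filter_basis F mul e \<longrightarrow>
            continuous_on UNIV (coord_functional F mul e k))"
proof (intro conjI allI impI)
  fix e :: "nat \<Rightarrow> 'a" and k
  assume "filter_basis F scaleR e"
  then show "continuous_on UNIV (coord_functional F scaleR e k)"
    by (rule continuous_coord_functional[OF assms(2,4) bounded_bilinear_scaleR])
next
  fix mul :: "complex \<Rightarrow> 'b \<Rightarrow> 'b" and e k
  assume "complex_banach mul" "filter_basis F mul e"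
  then show "continuous_on UNIV (coord_functional F mul e k)"
    by (intro continuous_coord_functional[OF assms(2,4)] complex_banach.bounded_bilinear_mul)
qed

end
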